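(* As $n \to \infty$, $$\left[b^{\lfloor (n-1)/2 \rfloor} a^{\lceil (n-1)/2 \rceil}\right] = \left( \frac{1}{2 \log 2\sqrt{1 - \log 2}} + o(1) \right) \left( \frac{1}{2 \log 2} \right)^n n!.$$
   Context: Let $S_n$ be the set of permutations of $[n]=\{1,\dots,n\}$. For $\pi \in S_n$, an index $i \in [n-1]$ is an excedance of $\pi$ if $\pi(i) > i$. The excedance word of $\pi$ is $w(\pi) = (w_1,\dots,w_{n-1}) \in \{a,b\}^{n-1}$ with $w_i = b$ if $\pi(i) > i$ and $w_i = a$ if $\pi(i) \le i$. For a word $w \in \{a,b\}^{n-1}$, $[w]$ denotes the number of $\pi \in S_n$ with $w(\pi) = w$. For non-negative integers $r+s=n-1$, $b^r a^s$ denotes the word whose first $r$ letters are $b$ and last $s$ letters are $a$; thus $[b^r a^s]$ is the number of $\pi\in S_n$ such that $\pi(i)>i$ holds exactly for $i \in \{1,\dots,r\}$ among $i\in[n-1]$. *)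

theory Defs
  imports "HOL-Analysis.Analysis" "HOL-Combinatorics.Permutations"
begin

text \<open>Excedance word of a permutation p of {1..n}: letter i (1 \<le> i \<le> n-1) is b iff p i > i.\<close>
definition exc_word :: "nat \<Rightarrow> (nat \<Rightarrow> nat) \<Rightarrow> nat \<Rightarrow> bool" where
  "exc_word n p i = (p i > i)"

text \<open>[b^r a^s] with r + s = n - 1: number of permutations of {1..n} whose excedances
  among 1..n-1 are exactly 1..r.\<close>
definition count_bras :: "nat \<Rightarrow> nat \<Rightarrow> nat" where
  "count_bras n r = card {p. p permutes {1..n} \<and> (\<forall>i\<in>{1..n-1}. exc_word n p i \<longleftrightarrow> i \<le> r)}"

end

theory Submission
  imports
    Defs
    "HOL-Combinatorics.Stirling"
    "HOL-Complex_Analysis.Complex_Analysis"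
    "HOL-Probability.Probability"
    "HOL-Real_Asymp.Real_Asymp"
begin

text \<open>
  Cutting the permutation matrix into the blocks given by \<open>{1..r}\<close> and \<open>{r+1..n}\<close>, the
  excedance condition imposes a staircase shape on the two diagonal blocks and nothing on the
  other two. Counting the rooks in the diagonal blocks gives
  \<open>[b\<^sup>r a\<^sup>s] = (\<Sum>j. (j!)\<^sup>2 S(r, j) S(s + 2, j + 1))\<close>. Up to explicit factors,
  \<open>j! S(m, j)\<close> is the probability that a random walk with positive integer steps is at \<open>m\<close>
  after \<open>j\<close> steps. A local limit theorem for this walk, together with an exponential bound
  obtained by shifting the contour in Cauchy's formula, turns the rescaled sum over \<open>j\<close> into a
  Gaussian integral by dominated convergence. The asymptotics of the central binomial
  coefficient then yield the constant.
\<close>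

section \<open>Rook placements and the excedance count\<close>

text \<open>Why \<open>ln 2\<close>: on a circle of radius \<open>a\<close>, Cauchy's formula bounds
  the term of index \<open>j\<close> through the exponential weight
  \<open>(exp a - 1) ^ (2 * j)\<close>, besides a factor free of \<open>j\<close>. In the balanced
  case one radius serves both Stirling numbers, and at \<open>a = ln 2\<close> this weight is 1.
  Both walks then have drift \<open>2 * ln 2\<close>, so their hitting probabilities peak at the
  same \<open>j\<close>, about \<open>r / (2 * ln 2)\<close>, with width of order
  \<open>sqrt r\<close>. Two probabilities of order \<open>1 / sqrt r\<close>, a factor
  \<open>1 / Suc j\<close> and a window of width \<open>sqrt r\<close> explain the order
  \<open>1 / (r * sqrt r)\<close> of the sum. The obstacle is uniformity: the local limit theorem
  speaks only of deviations that converge on the scale \<open>sqrt j\<close>, while the sum reaches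
  down to \<open>j = 1\<close>, where \<open>m / j\<close> is large. An exponential bound for one of
  the two probabilities outweighs this; for the other the order \<open>1 / sqrt j\<close> is
  enough.\<close>

definition rook_placements :: "('a \<times> 'b) set \<Rightarrow> nat \<Rightarrow> ('a \<times> 'b) set set" where
  "rook_placements B k = {F. F \<subseteq> B \<and> inj_on fst F \<and> inj_on snd F \<and> card F = k}"

lemma finite_rook_placements: "finite B \<Longrightarrow> finite (rook_placements B k)"
  by (rule finite_subset[of _ "Pow B"]) (auto simp: rook_placements_def)

lemma rook_placements_0: "finite B \<Longrightarrow> rook_placements B 0 = {{}}"
  by (auto simp: rook_placements_def dest: finite_subset)

lemma rook_placements_eq_empty:
  assumes "finite B" "card (fst ` B) < k"
  shows "rook_placements B k = {}"
proof -
  have "card F < k" if "F \<in> rook_placements B k" for F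
  proof -
    have "card F = card (fst ` F)" "F \<subseteq> B"
      using that by (simp_all add: rook_placements_def card_image)
    then show ?thesis
      using assms card_mono[of "fst ` B" "fst ` F"] by (simp add: image_mono)
  qed
  then show ?thesis by (fastforce simp: rook_placements_def)
qed

text \<open>Either row \<open>x\<close> stays empty, or its rook stands in a column of
  \<open>C\<close> that the other \<open>k\<close> rooks leave free. Since all columns of
  \<open>B\<close> lie in \<open>C\<close>, the number of free columns does not depend on the
  placement. The truncated difference is harmless: for \<open>k > card C\<close> there are no
  placements of \<open>k\<close> rooks on \<open>B\<close>.\<close>

lemma card_rook_placements_add_row:
  assumes fin: "finite B" "finite C" and x: "x \<notin> fst ` B" and C: "snd ` B \<subseteq> C"
  shows "card (rook_placements (B \<union> {x} \<times> C) (Suc k)) =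
    card (rook_placements B (Suc k)) + (card C - k) * card (rook_placements B k)"
proof -
  let ?S = "SIGMA F:rook_placements B k. C - snd ` F"
  let ?f = "\<lambda>(F, c). insert (x, c) F"
  have notin: "(x, c) \<notin> F" if "F \<in> rook_placements B k" for F c k
    using that x by (force simp: rook_placements_def)
  have finF: "finite F" if "F \<subseteq> B \<union> {x} \<times> C" for F
    using that fin by (meson finite_SigmaI finite_UnI finite.intros finite_subset)
  have "rook_placements (B \<union> {x} \<times> C) (Suc k) = rook_placements B (Suc k) \<union> ?f ` ?S"
  proof (intro equalityI subsetI)
    fix F assume F: "F \<in> rook_placements (B \<union> {x} \<times> C) (Suc k)"
    have F': "F \<subseteq> B \<union> {x} \<times> C" "inj_on fst F" "inj_on snd F" "card F = Suc k" "finite F"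
      using F finF by (auto simp: rook_placements_def)
    show "F \<in> rook_placements B (Suc k) \<union> ?f ` ?S"
    proof (cases "\<exists>c. (x, c) \<in> F")
      case False
      then have "F \<subseteq> B" using F' by blast
      then show ?thesis using F' by (auto simp: rook_placements_def)
    next
      case True
      then obtain c where c: "(x, c) \<in> F" by blast
      have sub: "F - {(x, c)} \<subseteq> B"
      proof
        fix p assume p: "p \<in> F - {(x, c)}"
        have "fst p \<noteq> x" using inj_onD[OF F'(2), of p "(x, c)"] p c by auto
        then show "p \<in> B" using p F' by auto
      qed
      have "F - {(x, c)} \<in> rook_placements B k"
        using sub F' c by (auto simp: rook_placements_def intro: inj_on_subset)
      moreover have "c \<in> C"
        using subsetD[OF F'(1) c] x by (auto simp: image_iff)
      moreover have "c \<notin> snd ` (F - {(x, c)})"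
      proof
        assume "c \<in> snd ` (F - {(x, c)})"
        then obtain y where "(y, c) \<in> F - {(x, c)}" by (metis imageE prod.collapse)
        then show False using inj_onD[OF F'(3), of "(y, c)" "(x, c)"] c by simp
      qed
      ultimately have "(F - {(x, c)}, c) \<in> ?S" by blast
      moreover have "F = ?f (F - {(x, c)}, c)" using c by auto
      ultimately show ?thesis by blast
    qed
  next
    fix F assume "F \<in> rook_placements B (Suc k) \<union> ?f ` ?S"
    then show "F \<in> rook_placements (B \<union> {x} \<times> C) (Suc k)"
    proof
      assume "F \<in> ?f ` ?S"
      then obtain G c where G: "G \<in> rook_placements B k" "c \<in> C" "c \<notin> snd ` G" "F = insert (x, c) G"
        by auto
      have "finite G" using G(1) fin(1) by (auto simp: rook_placements_def dest: finite_subset)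
      moreover have "x \<notin> fst ` G" using G(1) x by (auto simp: rook_placements_def)
      moreover have "inj_on fst (insert (x, c) G)" "inj_on snd (insert (x, c) G)"
        using G(1,3) \<open>x \<notin> fst ` G\<close> by (auto simp: rook_placements_def image_iff)
      moreover have "card (insert (x, c) G) = Suc k"
        using G(1) notin[OF G(1)] \<open>finite G\<close> by (simp add: rook_placements_def)
      moreover have "insert (x, c) G \<subseteq> B \<union> {x} \<times> C"
        using G(1,2) by (auto simp: rook_placements_def)
      ultimately show ?thesis
        using G(4) by (simp add: rook_placements_def)
    qed (auto simp: rook_placements_def)
  qed
  moreover have "rook_placements B (Suc k) \<inter> ?f ` ?S = {}"
  proof -
    have "insert (x, c) G \<notin> rook_placements B (Suc k)" for G c
      using notin by blast
    then show ?thesis by auto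
  qed
  moreover have "inj_on ?f ?S"
  proof (rule inj_onI)
    fix p q assume pq: "p \<in> ?S" "q \<in> ?S" "?f p = ?f q"
    obtain F c G d where [simp]: "p = (F, c)" "q = (G, d)" by fastforce
    have eq: "insert (x, c) F = insert (x, d) G" using pq(3) by simp
    have "F \<in> rook_placements B k" "G \<in> rook_placements B k" using pq(1,2) by auto
    note no = this[THEN notin]
    have "(x, c) \<in> insert (x, d) G" using eq by blast
    then have "c = d" using no by simp
    moreover have "F = G" using eq no insert_ident \<open>c = d\<close> by metis
    ultimately show "p = q" by simp
  qed
  moreover have "card ?S = (card C - k) * card (rook_placements B k)"
  proof -
    have "card (C - snd ` F) = card C - k" if "F \<in> rook_placements B k" for F
    proof -
      have "card (snd ` F) = k" "snd ` F \<subseteq> C"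
        using that C by (auto simp: rook_placements_def card_image)
      then show ?thesis using card_Diff_subset[of "snd ` F" C] finite_subset[of "snd ` F" C] fin by simp
    qed
    then show ?thesis using fin by (simp add: finite_rook_placements)
  qed
  moreover have "finite ?S" using fin by (auto simp: finite_rook_placements)
  ultimately show ?thesis
    using fin by (simp add: card_Un_disjoint finite_rook_placements card_image)
qed

text \<open>Rook placements on a staircase are the arc diagrams of set partitions.\<close>

lemma card_rook_placements_staircase:
  assumes B: "B 0 = {}" "\<And>k. k < N \<Longrightarrow> B (Suc k) = B k \<union> {x k} \<times> C k"
    and x: "\<And>k. k < N \<Longrightarrow> x k \<notin> fst ` B k"
    and C: "\<And>k. k < N \<Longrightarrow> snd ` B k \<subseteq> C k" "\<And>k. k < N \<Longrightarrow> finite (C k)"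
      "\<And>k. k < N \<Longrightarrow> card (C k) = k"
    and k: "k \<le> N"
  shows "card (rook_placements (B k) l) = (if l \<le> k then Stirling k (k - l) else 0)"
  using k
proof (induction k arbitrary: l)
  case 0
  then show ?case
    using B(1) by (auto simp: rook_placements_0 rook_placements_eq_empty)
next
  case (Suc k)
  have fin: "finite (B m)" if "m \<le> N" for m
    using that by (induction m) (use B C in auto)
  show ?case
  proof (cases l)
    case 0
    then show ?thesis using fin[of "Suc k"] Suc.prems by (simp add: rook_placements_0)
  next
    case l: (Suc l')
    have rec: "card (rook_placements (B (Suc k)) (Suc l')) =
       card (rook_placements (B k) (Suc l')) + (k - l') * card (rook_placements (B k) l')"
      using card_rook_placements_add_row[of "B k" "C k" "x k" l'] fin[of k] B C x Suc.prems by simp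
    show ?thesis
    proof (cases "l' < k")
      case True
      \<comment> \<open>With this \<open>q\<close> the row recurrence reads
        \<open>S(k+1, q+1) = S(k, q) + (q+1) S(k, q+1)\<close>, the defining recurrence of
        \<open>Stirling\<close>.\<close>
      then obtain q where q: "k - l' = Suc q" by (metis Suc_diff_Suc)
      then have "k - Suc l' = q" by simp
      then show ?thesis
        using rec Suc.IH Suc.prems True q by (simp add: l)
    next
      case False
      then show ?thesis using rec Suc.IH Suc.prems by (auto simp: l)
    qed
  qed
qed

lemma card_rook_placements_Times:
  assumes "finite X" "finite Y"
  shows "card (rook_placements (X \<times> Y) (card X)) = (\<Prod>i<card X. card Y - i)"
  using assms(1)
proof (induction X)
  case empty
  then show ?case by (simp add: rook_placements_0)
next
  case (insert x X)
  have "insert x X \<times> Y = X \<times> Y \<union> {x} \<times> Y" by auto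
  \<comment> \<open>More rooks than rows: the new row cannot stay empty, and only the product term
    of the recurrence survives.\<close>
  moreover have "rook_placements (X \<times> Y) (Suc (card X)) = {}"
  proof (rule rook_placements_eq_empty)
    have "card (fst ` (X \<times> Y)) \<le> card X"
      using insert.hyps by (intro card_mono) auto
    then show "card (fst ` (X \<times> Y)) < Suc (card X)" by simp
  qed (use assms insert in auto)
  ultimately show ?case
    using card_rook_placements_add_row[of "X \<times> Y" Y x "card X"] insert assms
    by (simp add: image_subset_iff mult.commute)
qed

section \<open>Full placements on a board cut into four blocks\<close>

lemma prod_diff_eq_fact: "(\<Prod>i<k. k - i) = (fact k :: nat)"
  by (simp add: fact_prod_rev atLeast0LessThan)

lemma card_rook_placements_Times_fact:
  assumes "finite X" "finite Y" "card X = j" "card Y = j"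
  shows "card (rook_placements (X \<times> Y) j) = fact j"
  using card_rook_placements_Times[of X Y] assms by (simp add: prod_diff_eq_fact)

lemma inj_on_disjoint_Un:
  "inj_on f X \<Longrightarrow> inj_on f Y \<Longrightarrow> f ` X \<inter> f ` Y = {} \<Longrightarrow> inj_on f (X \<union> Y)"
  by (simp add: inj_on_Un) blast

text \<open>With \<open>a + b\<close> rooks every row and every column is occupied. If
  \<open>j\<close> rows of \<open>A\<close> use columns of \<open>B'\<close>, then \<open>j\<close>
  columns of \<open>A'\<close> are left for rows of \<open>B\<close>, so both off-diagonal blocks
  hold \<open>j\<close> rooks. Once the diagonal blocks are filled, these rooks form arbitrary
  bijections between the leftover rows and columns, whence \<open>fact j\<close> twice.\<close>

lemma card_full_rook_placements_blocks:
  fixes U W :: "('a \<times> 'b) set"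
  assumes fin: "finite A" "finite B" "finite A'" "finite B'"
    and disj: "A \<inter> B = {}" "A' \<inter> B' = {}"
    and card: "card A = a" "card A' = a" "card B = b" "card B' = b"
    and U: "U \<subseteq> A \<times> A'" and W: "W \<subseteq> B \<times> B'"
  shows "card (rook_placements (U \<union> W \<union> A \<times> B' \<union> B \<times> A') (a + b)) =
    (\<Sum>j\<le>min a b. card (rook_placements U (a - j)) * card (rook_placements W (b - j)) * (fact j)\<^sup>2)"
proof -
  let ?K = "\<lambda>G H. (A - fst ` G) \<times> (B' - snd ` H)"
  let ?L = "\<lambda>G H. (B - fst ` H) \<times> (A' - snd ` G)"
  let ?S = "SIGMA j:{..min a b}. SIGMA (G, H):rook_placements U (a - j) \<times> rook_placements W (b - j).
     rook_placements (?K G H) j \<times> rook_placements (?L G H) j"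
  let ?T = "rook_placements (U \<union> W \<union> A \<times> B' \<union> B \<times> A') (a + b)"
  let ?f = "\<lambda>(j :: nat, (G, H), (K, L)). G \<union> H \<union> K \<union> L"
  let ?g = "\<lambda>F. (card (F \<inter> A \<times> B'), (F \<inter> A \<times> A', F \<inter> B \<times> B'), (F \<inter> A \<times> B', F \<inter> B \<times> A'))"
  have finUW: "finite U" "finite W"
    using U W fin by (meson finite_SigmaI finite_subset)+
  have proj: "fst ` X \<subseteq> P" "snd ` X \<subseteq> Q" if "X \<subseteq> P \<times> Q" for X :: "('a \<times> 'b) set" and P Q
    using that by auto
  have "bij_betw ?f ?S ?T"
  proof (rule bij_betw_byWitness[where f' = ?g])
    show "\<forall>p\<in>?S. ?g (?f p) = p"
    proof
      fix p assume p: "p \<in> ?S"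
      obtain j G H K L where [simp]: "p = (j, (G, H), (K, L))"
        by (metis prod.exhaust)
      have sub: "G \<subseteq> A \<times> A'" "H \<subseteq> B \<times> B'" "K \<subseteq> A \<times> B'" "L \<subseteq> B \<times> A'" "card K = j"
        using p U W by (auto simp: rook_placements_def)
      have "(G \<union> H \<union> K \<union> L) \<inter> A \<times> A' = G" "(G \<union> H \<union> K \<union> L) \<inter> B \<times> B' = H"
        "(G \<union> H \<union> K \<union> L) \<inter> A \<times> B' = K" "(G \<union> H \<union> K \<union> L) \<inter> B \<times> A' = L"
        using sub disj by blast+
      then show "?g (?f p) = p" using sub by simp
    qed
  next
    show "\<forall>F\<in>?T. ?f (?g F) = F"
    proof
      fix F assume "F \<in> ?T"
      then have "F \<subseteq> A \<times> A' \<union> B \<times> B' \<union> A \<times> B' \<union> B \<times> A'"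
        using U W by (auto simp: rook_placements_def)
      then show "?f (?g F) = F" by auto
    qed
  next
    show "?f ` ?S \<subseteq> ?T"
    proof (rule image_subsetI)
      fix p assume p: "p \<in> ?S"
      obtain j G H K L where [simp]: "p = (j, (G, H), (K, L))"
        by (metis prod.exhaust)
      have j: "j \<in> {..min a b}" and G: "G \<in> rook_placements U (a - j)"
        and H: "H \<in> rook_placements W (b - j)" and K: "K \<in> rook_placements (?K G H) j"
        and L: "L \<in> rook_placements (?L G H) j"
        using p by simp_all
      have G': "G \<subseteq> U" "G \<subseteq> A \<times> A'" "inj_on fst G" "inj_on snd G" "card G = a - j" "finite G"
        using G U finUW by (auto simp: rook_placements_def dest: finite_subset)
      have H': "H \<subseteq> W" "H \<subseteq> B \<times> B'" "inj_on fst H" "inj_on snd H" "card H = b - j" "finite H"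
        using H W finUW by (auto simp: rook_placements_def dest: finite_subset)
      have K': "K \<subseteq> ?K G H" "inj_on fst K" "inj_on snd K" "card K = j" "finite K"
        using K fin by (auto simp: rook_placements_def dest: finite_subset)
      have L': "L \<subseteq> ?L G H" "inj_on fst L" "inj_on snd L" "card L = j" "finite L"
        using L fin by (auto simp: rook_placements_def dest: finite_subset)
      have cols: "fst ` G \<subseteq> A" "fst ` K \<subseteq> A - fst ` G" "fst ` H \<subseteq> B" "fst ` L \<subseteq> B - fst ` H"
        and rows: "snd ` G \<subseteq> A'" "snd ` L \<subseteq> A' - snd ` G" "snd ` H \<subseteq> B'" "snd ` K \<subseteq> B' - snd ` H"
        using proj[OF G'(2)] proj[OF H'(2)] proj[OF K'(1)] proj[OF L'(1)] by simp_all
      \<comment> \<open>Disjointness in the left-nested shape of the union of \<open>G\<close>,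
        \<open>H\<close>, \<open>K\<close>, \<open>L\<close>. For first coordinates \<open>G\<close>
        shares its range with \<open>K\<close>, and \<open>H\<close> with \<open>L\<close>; for
        second coordinates the partners are \<open>L\<close> and \<open>K\<close>, hence the variant
        \<open>sep'\<close>.\<close>
      have sep: "g \<inter> h = {} \<and> (g \<union> h) \<inter> k = {} \<and> (g \<union> h \<union> k) \<inter> l = {}"
        if "g \<subseteq> P" "k \<subseteq> P - g" "h \<subseteq> Q" "l \<subseteq> Q - h" "P \<inter> Q = {}" for g h k l P Q :: "'c set"
        using that by blast
      have sep': "g \<inter> h = {} \<and> (g \<union> h) \<inter> k = {} \<and> (g \<union> h \<union> k) \<inter> l = {}"
        if "g \<subseteq> P" "l \<subseteq> P - g" "h \<subseteq> Q" "k \<subseteq> Q - h" "P \<inter> Q = {}" for g h k l P Q :: "'c set"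
        using that by blast
      note d1 = sep[OF cols disj(1), folded image_Un] and d2 = sep'[OF rows disj(2), folded image_Un]
      have inter: "G \<inter> H = {}" "(G \<union> H) \<inter> K = {}" "(G \<union> H \<union> K) \<inter> L = {}"
        using d1 by (metis image_is_empty image_Int_subset subset_empty)+
      have inj_fst: "inj_on fst (G \<union> H \<union> K \<union> L)"
        using d1 G' H' K' L' by (simp add: inj_on_disjoint_Un)
      have inj_snd: "inj_on snd (G \<union> H \<union> K \<union> L)"
        using d2 G' H' K' L' by (simp add: inj_on_disjoint_Un)
      have "card (G \<union> H \<union> K \<union> L) = card G + card H + card K + card L"
        using inter G'(6) H'(6) K'(5) L'(5) by (simp add: card_Un_disjoint)
      also have "\<dots> = a + b"
        using G'(5) H'(5) K'(4) L'(4) j by simp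
      finally have "card (G \<union> H \<union> K \<union> L) = a + b" .
      moreover have "K \<subseteq> A \<times> B'" "L \<subseteq> B \<times> A'"
        using K'(1) L'(1) by auto
      then have "G \<union> H \<union> K \<union> L \<subseteq> U \<union> W \<union> A \<times> B' \<union> B \<times> A'"
        using G'(1) H'(1) by blast
      ultimately show "?f p \<in> ?T"
        using inj_fst inj_snd by (simp add: rook_placements_def)
    qed
  next
    show "?g ` ?T \<subseteq> ?S"
    proof (rule image_subsetI)
      fix F assume "F \<in> ?T"
      then have F: "F \<subseteq> U \<union> W \<union> A \<times> B' \<union> B \<times> A'" "inj_on fst F" "inj_on snd F" "card F = a + b"
        by (auto simp: rook_placements_def)
      let ?G = "F \<inter> A \<times> A'" and ?H = "F \<inter> B \<times> B'" and ?M = "F \<inter> A \<times> B'" and ?N = "F \<inter> B \<times> A'"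
      have finF: "finite F" using F(1) finUW fin by (meson finite_SigmaI finite_UnI finite_subset)
      have "F \<subseteq> (A \<union> B) \<times> (A' \<union> B')" using F(1) U W by blast
      note sub = proj[OF this]
      \<comment> \<open>Pigeonhole: \<open>a + b\<close> distinct first coordinates fill a set of
        size \<open>a + b\<close>; likewise for the second ones.\<close>
      have fstF: "fst ` F = A \<union> B"
        using sub(1) fin card disj card_image[OF F(2)] F(4)
        by (intro card_subset_eq) (simp_all add: card_Un_disjoint)
      have sndF: "snd ` F = A' \<union> B'"
        using sub(2) fin card disj card_image[OF F(3)] F(4)
        by (intro card_subset_eq) (simp_all add: card_Un_disjoint)
      have rowF: "fst ` (F \<inter> X \<times> (A' \<union> B')) = X" if X: "X \<subseteq> A \<union> B" for X
      proof (intro equalityI subsetI)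
        fix i assume i: "i \<in> X"
        then have "i \<in> fst ` F" using X fstF by blast
        then obtain v where "(i, v) \<in> F" by auto
        moreover then have "v \<in> A' \<union> B'" using sub(2) by (metis imageI snd_conv subsetD)
        ultimately have "(i, v) \<in> F \<inter> X \<times> (A' \<union> B')" using i by blast
        then show "i \<in> fst ` (F \<inter> X \<times> (A' \<union> B'))" by (metis fst_conv imageI)
      qed auto
      have colF: "snd ` (F \<inter> (A \<union> B) \<times> Y) = Y" if Y: "Y \<subseteq> A' \<union> B'" for Y
      proof (intro equalityI subsetI)
        fix v assume v: "v \<in> Y"
        then have "v \<in> snd ` F" using Y sndF by blast
        then obtain i where "(i, v) \<in> F" by auto
        moreover then have "i \<in> A \<union> B" using sub(1) by (metis imageI fst_conv subsetD)
        ultimately have "(i, v) \<in> F \<inter> (A \<union> B) \<times> Y" using v by blast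
        then show "v \<in> snd ` (F \<inter> (A \<union> B) \<times> Y)" by (metis snd_conv imageI)
      qed auto
      have inj: "inj_on fst X" "inj_on snd X" if "X \<subseteq> F" for X
        using F that by (auto intro: inj_on_subset)
      \<comment> \<open>Counting the rooks in the rows \<open>A\<close>, the columns
        \<open>A'\<close> and the rows \<open>B\<close> gives three equations, which force
        \<open>?M\<close> and \<open>?N\<close> to have equal size and fix the sizes of
        \<open>?G\<close> and \<open>?H\<close>.\<close>
      have "card (F \<inter> A \<times> (A' \<union> B')) = a"
        using card_image[OF inj(1)[OF Int_lower1]] rowF[OF Un_upper1] card(1) by metis
      moreover have "F \<inter> A \<times> (A' \<union> B') = ?G \<union> ?M"
        by (simp only: Sigma_Un_distrib2 Int_Un_distrib)
      moreover have "card (?G \<union> ?M) = card ?G + card ?M"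
        using finF disj by (intro card_Un_disjoint) auto
      ultimately have GM: "card ?G + card ?M = a"
        by simp
      have "card (F \<inter> (A \<union> B) \<times> A') = a"
        using card_image[OF inj(2)[OF Int_lower1]] colF[OF Un_upper1] card(2) by metis
      moreover have "F \<inter> (A \<union> B) \<times> A' = ?G \<union> ?N"
        by (simp only: Sigma_Un_distrib1 Int_Un_distrib)
      moreover have "card (?G \<union> ?N) = card ?G + card ?N"
        using finF disj by (intro card_Un_disjoint) auto
      ultimately have GN: "card ?G + card ?N = a"
        by simp
      have "card (F \<inter> B \<times> (A' \<union> B')) = b"
        using card_image[OF inj(1)[OF Int_lower1]] rowF[OF Un_upper2] card(3) by metis
      moreover have "F \<inter> B \<times> (A' \<union> B') = ?H \<union> ?N"
        by (simp only: Sigma_Un_distrib2 Int_Un_distrib Un_commute)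
      moreover have "card (?H \<union> ?N) = card ?H + card ?N"
        using finF disj by (intro card_Un_disjoint) auto
      ultimately have HN: "card ?H + card ?N = b"
        by simp
      have "?G \<subseteq> U" "?H \<subseteq> W" using F(1) disj U W by blast+
      then have "?G \<in> rook_placements U (a - card ?M)" "?H \<in> rook_placements W (b - card ?M)"
        using GM GN HN inj by (auto simp: rook_placements_def)
      moreover have row: "v = v'" if "(i, v) \<in> F" "(i, v') \<in> F" for i v v'
        using inj_onD[OF F(2), of "(i, v)" "(i, v')"] that by simp
      moreover have col: "i = i'" if "(i, v) \<in> F" "(i', v) \<in> F" for i i' v
        using inj_onD[OF F(3), of "(i, v)" "(i', v)"] that by simp
      have "?M \<subseteq> ?K ?G ?H"
        using disj by (auto dest: row col)
      then have "?M \<in> rook_placements (?K ?G ?H) (card ?M)"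
        using inj[of ?M] by (simp add: rook_placements_def)
      moreover have "?N \<subseteq> ?L ?G ?H"
        using disj by (auto dest: row col)
      then have "?N \<in> rook_placements (?L ?G ?H) (card ?M)"
        using inj[of ?N] GM GN by (simp add: rook_placements_def)
      moreover have "card ?M \<in> {..min a b}" using GM GN HN by simp
      ultimately show "?g F \<in> ?S" by simp
    qed
  qed
  then have "card ?T = card ?S" by (simp add: bij_betw_same_card)
  also have "\<dots> = (\<Sum>j\<le>min a b. \<Sum>(G, H)\<in>rook_placements U (a - j) \<times> rook_placements W (b - j).
     card (rook_placements (?K G H) j) * card (rook_placements (?L G H) j))"
    using fin finUW by (subst card_SigmaI)
      (auto simp: finite_rook_placements card_cartesian_product intro!: sum.cong finite_SigmaI)
  also have "\<dots> = (\<Sum>j\<le>min a b. \<Sum>(G, H)\<in>rook_placements U (a - j) \<times> rook_placements W (b - j). (fact j)\<^sup>2)"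
  proof (intro sum.cong refl)
    fix j x
    assume j: "j \<in> {..min a b}" and x: "x \<in> rook_placements U (a - j) \<times> rook_placements W (b - j)"
    obtain G H where [simp]: "x = (G, H)" by fastforce
    have G: "G \<in> rook_placements U (a - j)" and H: "H \<in> rook_placements W (b - j)"
      using x by simp_all
    have "card (fst ` G) = a - j" "card (snd ` G) = a - j" "fst ` G \<subseteq> A" "snd ` G \<subseteq> A'"
      using G U by (auto simp: rook_placements_def card_image)
    then have 1: "card (A - fst ` G) = j" "card (A' - snd ` G) = j"
      using j card fin by (auto simp: card_Diff_subset finite_subset)
    have "card (fst ` H) = b - j" "card (snd ` H) = b - j" "fst ` H \<subseteq> B" "snd ` H \<subseteq> B'"
      using H W by (auto simp: rook_placements_def card_image)
    then have 2: "card (B - fst ` H) = j" "card (B' - snd ` H) = j"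
      using j card fin by (auto simp: card_Diff_subset finite_subset)
    show "(case x of (G, H) \<Rightarrow> card (rook_placements (?K G H) j) * card (rook_placements (?L G H) j)) =
      (case x of (G, H) \<Rightarrow> (fact j)\<^sup>2)"
      using 1 2 fin by (simp add: card_rook_placements_Times_fact power2_eq_square)
  qed
  also have "\<dots> = (\<Sum>j\<le>min a b. card (rook_placements U (a - j)) * card (rook_placements W (b - j))
      * (fact j)\<^sup>2)"
    by (simp add: card_cartesian_product split_beta)
  finally show ?thesis .
qed

text \<open>A permutation is sent to its graph. Conversely, \<open>card S\<close> rooks on a board
  inside \<open>S \<times> S\<close> occupy every row and column, hence form the graph of a
  bijection.\<close>

lemma bij_betw_permutations_rook_placements:
  assumes B: "\<And>i v. (i, v) \<in> B \<longleftrightarrow> i \<in> S \<and> v \<in> S \<and> P i v" and S: "finite S"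
  shows "bij_betw (\<lambda>p. (\<lambda>i. (i, p i)) ` S) {p. p permutes S \<and> (\<forall>i\<in>S. P i (p i))}
    (rook_placements B (card S))"
proof (rule bij_betw_imageI)
  show "inj_on (\<lambda>p. (\<lambda>i. (i, p i)) ` S) {p. p permutes S \<and> (\<forall>i\<in>S. P i (p i))}"
  proof (rule inj_onI, clarify, rule ext)
    fix p q i
    assume p: "p permutes S" and q: "q permutes S" and eq: "(\<lambda>i. (i, p i)) ` S = (\<lambda>i. (i, q i)) ` S"
    show "p i = q i"
    proof (cases "i \<in> S")
      case True
      then have "(i, p i) \<in> (\<lambda>i. (i, q i)) ` S" using eq by blast
      then show ?thesis by auto
    next
      case False
      then show ?thesis using p q by (simp add: permutes_not_in)
    qed
  qed
  show "(\<lambda>p. (\<lambda>i. (i, p i)) ` S) ` {p. p permutes S \<and> (\<forall>i\<in>S. P i (p i))} = rook_placements B (card S)"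
  proof (intro equalityI image_subsetI subsetI)
    fix p assume "p \<in> {p. p permutes S \<and> (\<forall>i\<in>S. P i (p i))}"
    then have p: "p permutes S" "\<And>i. i \<in> S \<Longrightarrow> P i (p i)" by auto
    have "inj_on snd ((\<lambda>i. (i, p i)) ` S)"
      using permutes_inj_on[OF p(1), of S] by (simp add: inj_on_def)
    moreover have "inj_on fst ((\<lambda>i. (i, p i)) ` S)"
      by (simp add: inj_on_def)
    moreover have "card ((\<lambda>i. (i, p i)) ` S) = card S"
      by (intro card_image inj_onI) simp
    moreover have "(\<lambda>i. (i, p i)) ` S \<subseteq> B"
      using p(2) permutes_in_image[OF p(1)] B by (intro image_subsetI) blast
    ultimately show "(\<lambda>i. (i, p i)) ` S \<in> rook_placements B (card S)"
      by (simp add: rook_placements_def)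
  next
    fix F assume "F \<in> rook_placements B (card S)"
    then have F: "F \<subseteq> B" "inj_on fst F" "inj_on snd F" "card F = card S"
      by (auto simp: rook_placements_def)
    have "fst ` F \<subseteq> S" "snd ` F \<subseteq> S" using F(1) B by force+
    then have fst: "fst ` F = S" and snd: "snd ` F = S"
      using F(4) S card_image[OF F(2)] card_image[OF F(3)]
      by (simp_all add: card_subset_eq)
    \<comment> \<open>The identity outside \<open>S\<close> is what \<open>permutes\<close> asks
      for.\<close>
    define p where "p i = (if i \<in> S then THE v. (i, v) \<in> F else i)" for i
    have pF: "p i = v" if "(i, v) \<in> F" for i v
    proof -
      have "i \<in> S" using that fst by force
      moreover have "(THE v. (i, v) \<in> F) = v"
      proof (rule the_equality)
        show "v' = v" if "(i, v') \<in> F" for v'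
          using inj_onD[OF F(2) _ that \<open>(i, v) \<in> F\<close>] by simp
      qed fact
      ultimately show ?thesis by (simp add: p_def)
    qed
    have pF': "(i, p i) \<in> F" if "i \<in> S" for i
    proof -
      have "i \<in> fst ` F" using that fst by simp
      then obtain v where "(i, v) \<in> F" by auto
      then show ?thesis using pF by blast
    qed
    have Feq: "F = (\<lambda>i. (i, p i)) ` S"
    proof (intro equalityI subsetI)
      fix x assume x: "x \<in> F"
      then have "fst x \<in> S" "x = (fst x, p (fst x))"
        using fst pF[of "fst x" "snd x"] by (auto intro: prod_eqI)
      then show "x \<in> (\<lambda>i. (i, p i)) ` S" by blast
    qed (use pF' in auto)
    then have "p ` S = S" using snd by (simp add: image_image)
    then have "bij_betw p S S"
      using S by (simp add: bij_betw_def eq_card_imp_inj_on)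
    then have "p permutes S"
      by (rule bij_imp_permutes) (simp add: p_def)
    moreover have "P i (p i)" if "i \<in> S" for i using pF'[OF that] F(1) B by blast
    ultimately show "F \<in> (\<lambda>p. (\<lambda>i. (i, p i)) ` S) ` {p. p permutes S \<and> (\<forall>i\<in>S. P i (p i))}"
      using Feq by blast
  qed
qed

text \<open>Excedances confine the rows \<open>1..r\<close> to cells strictly above the diagonal,
  non-excedances confine the other rows to cells weakly below it. Off the diagonal blocks both
  conditions hold by themselves. The strict staircase has row lengths \<open>0..r-1\<close>, the
  weak one \<open>1..n-r\<close>; prefixing the latter with an empty row makes it a staircase with
  one more row, which is the origin of both shifts in
  \<open>Stirling (Suc (n - r)) (Suc j)\<close>.\<close>

lemma count_bras_eq_sum_Stirling:
  assumes "r < n"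
  shows "count_bras n r = (\<Sum>j\<le>r. (fact j)\<^sup>2 * Stirling r j * Stirling (Suc (n - r)) (Suc j))"
proof -
  define t where "t = n - r"
  define A where "A = {1..r}"
  define B where "B = {r+1..n}"
  define U where "U = {(i, v). i \<in> A \<and> v \<in> A \<and> i < v}"
  define W where "W = {(i, v). i \<in> B \<and> v \<in> B \<and> v \<le> i}"
  let ?P = "\<lambda>i v. v > i \<longleftrightarrow> i \<le> r"
  have AB: "finite A" "finite B" "A \<inter> B = {}" "card A = r" "card B = t"
    by (auto simp: A_def B_def t_def)
  have "{p. p permutes {1..n} \<and> (\<forall>i\<in>{1..n-1}. exc_word n p i \<longleftrightarrow> i \<le> r)} =
      {p. p permutes {1..n} \<and> (\<forall>i\<in>{1..n}. ?P i (p i))}"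
  proof (intro Collect_cong conj_cong refl)
    fix p assume p: "p permutes {1..n}"
    \<comment> \<open>The word has no letter for the index \<open>n\<close>, but
      \<open>p n \<le> n\<close> and \<open>r < n\<close> make the condition there
      automatic.\<close>
    have "p n \<in> {1..n}" using p assms by (simp only: permutes_in_image) simp
    then have "?P n (p n)" using assms by auto
    moreover have "{1..n} = insert n {1..n-1}" using assms by auto
    ultimately show "(\<forall>i\<in>{1..n-1}. exc_word n p i \<longleftrightarrow> i \<le> r) \<longleftrightarrow> (\<forall>i\<in>{1..n}. ?P i (p i))"
      by (simp add: exc_word_def)
  qed
  then have "count_bras n r = card {p. p permutes {1..n} \<and> (\<forall>i\<in>{1..n}. ?P i (p i))}"
    by (simp add: count_bras_def)
  also have "\<dots> = card (rook_placements (U \<union> W \<union> A \<times> B \<union> B \<times> A) (card {1..n}))"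
    using assms by (intro bij_betw_same_card[OF bij_betw_permutations_rook_placements])
      (auto simp: U_def W_def A_def B_def)
  also have "card {1..n} = r + t" using assms by (simp add: t_def)
  also have "card (rook_placements (U \<union> W \<union> A \<times> B \<union> B \<times> A) (r + t)) =
      (\<Sum>j\<le>min r t. card (rook_placements U (r - j)) * card (rook_placements W (t - j)) * (fact j)\<^sup>2)"
    using AB by (intro card_full_rook_placements_blocks) (auto simp: U_def W_def)
  also have "\<dots> = (\<Sum>j\<le>min r t. (fact j)\<^sup>2 * Stirling r j * Stirling (Suc t) (Suc j))"
  proof (rule sum.cong)
    fix j assume "j \<in> {..min r t}"
    then have j: "j \<le> r" "j \<le> t" by auto
    \<comment> \<open>Built upwards from row \<open>r\<close>: row \<open>r - k\<close> offers the
      \<open>k\<close> columns to its right.\<close>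
    let ?U = "\<lambda>k. {(i, v). r - k < i \<and> i < v \<and> v \<le> r}"
    have "card (rook_placements (?U r) (r - j)) =
      (if r - j \<le> r then Stirling r (r - (r - j)) else 0)"
      by (rule card_rook_placements_staircase[where N = r and x = "\<lambda>k. r - k" and C = "\<lambda>k. {r-k<..r}"])
        (auto simp: image_subset_iff)
    moreover have "?U r = U" by (auto simp: U_def A_def)
    ultimately have 1: "card (rook_placements U (r - j)) = Stirling r j" using j by simp
    \<comment> \<open>The rows start with \<open>r\<close> itself, which is empty, so that row
      \<open>r + k\<close> has \<open>k\<close> cells as the staircase lemma demands.\<close>
    let ?W = "\<lambda>k. {(i, v). r < v \<and> v \<le> i \<and> i < r + k}"
    have "card (rook_placements (?W (Suc t)) (t - j)) =
      (if t - j \<le> Suc t then Stirling (Suc t) (Suc t - (t - j)) else 0)"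
      by (rule card_rook_placements_staircase[where N = "Suc t" and x = "\<lambda>k. r + k" and C =
          "\<lambda>k. {r<..r+k}"])
        (auto simp: image_subset_iff)
    moreover have "?W (Suc t) = W" using assms by (auto simp: W_def B_def t_def)
    moreover have "Suc t - (t - j) = Suc j" using j by simp
    ultimately have 2: "card (rook_placements W (t - j)) = Stirling (Suc t) (Suc j)" by simp
    show "card (rook_placements U (r - j)) * card (rook_placements W (t - j)) * (fact j)\<^sup>2 =
      (fact j)\<^sup>2 * Stirling r j * Stirling (Suc t) (Suc j)" by (simp add: 1 2)
  qed simp
  also have "\<dots> = (\<Sum>j\<le>r. (fact j)\<^sup>2 * Stirling r j * Stirling (Suc t) (Suc j))"
    by (rule sum.mono_neutral_left) auto
  finally show ?thesis by (simp add: t_def)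
qed

section \<open>A random walk attached to the Stirling numbers\<close>

text \<open>The probability that the \<open>j\<close>-th partial sum of a random walk whose steps are
  Poisson(\<open>ln 2\<close>) variables conditioned to be positive equals \<open>m\<close>. The parameter \<open>ln 2\<close> makes
  the weights \<open>(ln 2)\<^sup>k / k!\<close>, \<open>k \<ge> 1\<close>, sum to 1. A step has mean \<open>2 ln 2\<close> and variance
  \<open>2 ln 2 (1 - ln 2)\<close>.\<close>

definition hit_prob :: "nat \<Rightarrow> nat \<Rightarrow> real" where
  "hit_prob j m = ln 2 ^ m * fact j * real (Stirling m j) / fact m"

lemma hit_prob_nonneg: "0 \<le> hit_prob j m"
  by (simp add: hit_prob_def)

text \<open>\<open>(exp z - 1) ^ j\<close> is the exponential generating function of surjections
  onto \<open>j\<close> points. Its derivative is \<open>j\<close> times the sum of the powers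
  \<open>j\<close> and \<open>j - 1\<close>, which is the Stirling recurrence multiplied by
  \<open>fact j\<close>; therefore the induction on \<open>m\<close> runs over all \<open>j\<close>
  at once.\<close>

lemma higher_deriv_exp_minus_one_power:
  "(deriv ^^ m) (\<lambda>z. (exp z - 1) ^ j) (0 :: complex) = fact j * of_nat (Stirling m j)"
proof (induction m arbitrary: j)
  case 0
  then show ?case by (cases j) auto
next
  case (Suc m)
  show ?case
  proof (cases j)
    case 0
    then show ?thesis by (simp del: funpow.simps)
  next
    case (Suc i)
    let ?f = "\<lambda>j (z :: complex). (exp z - 1) ^ j"
    have "deriv (?f j) z = of_nat j * ?f j z + of_nat j * ?f i z" for z
    proof -
      have "(?f j has_field_derivative of_nat j * ?f i z * exp z) (at z)"
      proof -
        have "((\<lambda>z. exp z - 1) has_field_derivative exp z) (at z)"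
          by (auto intro!: derivative_eq_intros)
        moreover have "j - Suc 0 = i" using Suc by simp
        ultimately show ?thesis
          using DERIV_power[of "\<lambda>z. exp z - 1" "exp z" z UNIV j] by (simp add: mult_ac)
      qed
      moreover have "of_nat j * ?f i z * exp z = of_nat j * ?f j z + of_nat j * ?f i z"
        by (simp add: Suc algebra_simps)
      ultimately show ?thesis by (simp add: DERIV_imp_deriv)
    qed
    then have "deriv (?f j) = (\<lambda>z. of_nat j * ?f j z + of_nat j * ?f i z)" by blast
    then have "(deriv ^^ Suc m) (?f j) 0 = (deriv ^^ m) (\<lambda>z. of_nat j * ?f j z + of_nat j * ?f i z) 0"
      by (simp add: funpow_Suc_right del: funpow.simps)
    also have "\<dots> = (deriv ^^ m) (\<lambda>z. of_nat j * ?f j z) 0 + (deriv ^^ m) (\<lambda>z. of_nat j * ?f i z) 0"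
      by (rule higher_deriv_add[where S = UNIV]) (auto intro!: holomorphic_intros)
    also have "\<dots> = of_nat j * (fact j * of_nat (Stirling m j)) + of_nat j
        * (fact i * of_nat (Stirling m i))"
      by (subst (1 2) higher_deriv_cmult[where A = UNIV]) (auto intro!: holomorphic_intros simp: Suc.IH)
    also have "\<dots> = fact j * of_nat (Stirling (Suc m) j)"
      by (simp add: Suc algebra_simps)
    finally show ?thesis .
  qed
qed

section \<open>Hitting probabilities as Cauchy integrals\<close>

lemma has_integral_shift_period:
  fixes g :: "real \<Rightarrow> 'a::banach"
  assumes I: "(g has_integral I) {0..2*p}" and p: "p \<ge> 0" and per: "\<And>x. g (x + 2 * p) = g x"
  shows "(g has_integral I) {-p..p}"
proof -
  have int: "g integrable_on {0..2*p}" using I by blast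
  have int1: "g integrable_on {0..p}" and int2: "g integrable_on {p..2*p}"
    by (rule integrable_on_subinterval[OF int]; use p in auto)+
  have I_eq: "I = integral {0..p} g + integral {p..2*p} g"
    using Henstock_Kurzweil_Integration.integral_combine[of 0 p "2*p" g] int p integral_unique[OF I]
        by simp
  have "((\<lambda>x. g (x + 2*p)) has_integral integral {p..2*p} g) {p - 2*p..2*p - 2*p}"
    using has_integral_shift_Icc_real[of g "2*p" "integral {p..2*p} g" "p - 2*p"
        "2*p - 2*p"] integrable_integral[OF int2]
    by (simp add: o_def add.commute)
  then have "(g has_integral integral {p..2*p} g) {-p..0}"
    by (simp add: per o_def add.commute)
  from has_integral_combine[OF _ _ this integrable_integral[OF int1]]
  show ?thesis using p by (simp add: I_eq add.commute)
qed

text \<open>Cauchy's formula for the Taylor coefficient on the circle of radius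
  \<open>ln 2 * exp t\<close>; the factor \<open>ln 2 ^ m\<close> of \<open>hit_prob\<close> absorbs
  that part of the radius. At \<open>t = 0\<close> this inverts the characteristic function of the
  walk, while other \<open>t\<close> correspond to exponential tilting.\<close>

lemma hit_prob_Cauchy:
  fixes t :: real and j m :: nat and g :: "real \<Rightarrow> complex"
  defines "g \<equiv> \<lambda>\<theta>::real. (exp (of_real (ln 2) * exp (Complex t \<theta>)) - 1) ^ j
      * exp (- (of_nat m * Complex t \<theta>))"
  shows "integrable lborel (\<lambda>\<theta>. indicator {-pi..pi} \<theta> *\<^sub>R g \<theta>)"
    and "complex_of_real (hit_prob j m) =
        (1 / (2 * pi)) * (LINT \<theta>|lborel. indicator {-pi..pi} \<theta> *\<^sub>R g \<theta>)"
proof -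
  let ?R = "ln 2 * exp t"
  let ?f = "\<lambda>z::complex. (exp z - 1) ^ j"
  let ?D = "fact j * of_nat (Stirling m j) :: complex"
  have R: "?R > 0" by simp
  have Cpl: "exp (Complex t x) = of_real (exp t) * cis x" for x
    by (simp add: exp_eq_polar)
  have cont: "continuous_on A g" for A
    unfolding g_def Complex_eq by (intro continuous_intros)
  have "((\<lambda>u. ?f u / (u - 0) ^ Suc m) has_contour_integral (2 * pi * \<i> / fact m * (deriv ^^ m) ?f 0))
      (circlepath 0 ?R)"
    using R by (intro Cauchy_has_contour_integral_higher_derivative_circlepath continuous_intros
        holomorphic_intros) auto
  then have "((\<lambda>u. ?f u / u ^ Suc m) has_contour_integral (2 * pi * \<i> / fact m * ?D))
      (part_circlepath 0 ?R 0 (2 * pi))"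
    unfolding higher_deriv_exp_minus_one_power circlepath_def by simp
  then have "((\<lambda>x. ?f (?R * cis x) / (?R * cis x) ^ Suc m * ?R * \<i> * cis x) has_integral (2 * pi * \<i>
      / fact m * ?D)) {0..2*pi}"
    by (subst (asm) has_contour_integral_part_circlepath_iff) auto
  then have "((\<lambda>x. (of_real (ln 2 ^ m) / \<i>)
      * (?f (?R * cis x) / (?R * cis x) ^ Suc m * ?R * \<i> * cis x)) has_integral (of_real (ln 2 ^ m)
      / \<i>) * (2 * pi * \<i> / fact m * ?D)) {0..2*pi}"
    by (rule has_integral_mult_right)
  also have "(\<lambda>x. (of_real (ln 2 ^ m) / \<i>)
      * (?f (?R * cis x) / (?R * cis x) ^ Suc m * ?R * \<i> * cis x)) = g"
  proof
    fix x
    have "exp (- (of_nat m * Complex t x)) = 1 / exp (Complex t x) ^ m"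
      by (simp add: exp_minus exp_of_nat_mult field_simps)
    then show "(of_real (ln 2 ^ m) / \<i>) * (?f (?R * cis x) / (?R * cis x) ^ Suc m * ?R * \<i> * cis x) =
        g x"
      by (simp add: g_def Cpl power_mult_distrib field_simps)
  qed
  also have "(of_real (ln 2 ^ m) / \<i>) * (2 * pi * \<i> / fact m * ?D) =
      complex_of_real (2 * pi * hit_prob j m)"
    by (simp add: hit_prob_def field_simps)
  \<comment> \<open>The parameter range is centred at 0, where the modulus of the integrand peaks,
    so that Gaussian bounds in the angle apply.\<close>
  finally have "(g has_integral complex_of_real (2 * pi * hit_prob j m)) {-pi..pi}"
  proof (rule has_integral_shift_period)
    have "exp (Complex t (x + 2 * pi)) = exp (Complex t x)" for x
      by (simp add: Cpl flip: cis_mult)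
    then have "exp (Complex t (x + 2 * pi)) ^ m = exp (Complex t x) ^ m" for x by simp
    then show "g (x + 2 * pi) = g x" for x
      by (simp add: g_def Cpl exp_minus exp_of_nat_mult flip: cis_mult)
  qed simp
  then have "((\<lambda>\<theta>. indicator {-pi..pi} \<theta> *\<^sub>R g \<theta>) has_integral complex_of_real (2 * pi
      * hit_prob j m)) UNIV"
    by (subst (asm) has_integral_restrict_UNIV[symmetric])
        (simp add: indicator_def of_bool_def if_distrib if_distribR cong: if_cong)
  moreover show int: "integrable lborel (\<lambda>\<theta>. indicator {-pi..pi} \<theta> *\<^sub>R g \<theta>)"
    by (rule borel_integrable_compact) (use cont in auto)
  ultimately have "(LINT \<theta>|lborel. indicator {-pi..pi} \<theta> *\<^sub>R g \<theta>) =
      complex_of_real (2 * pi * hit_prob j m)"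
    using has_integral_integral_lborel[OF int] has_integral_unique by blast
  then show "complex_of_real (hit_prob j m) =
      (1 / (2 * pi)) * (LINT \<theta>|lborel. indicator {-pi..pi} \<theta> *\<^sub>R g \<theta>)"
    by simp
qed

section \<open>Decay of the step generating function along circles\<close>

lemma cos_le_quadratic:
  fixes x :: real
  assumes "\<bar>x\<bar> \<le> pi"
  shows "x\<^sup>2 / 18 \<le> 1 - cos x"
proof -
  define y where "y = \<bar>x\<bar> / 2"
  \<comment> \<open>On \<open>[0, 2]\<close> the cubic bound gives \<open>sin y \<ge> y / 3\<close>;
    then \<open>1 - cos x = 2 * (sin y)\<^sup>2\<close> yields the constant
    \<open>2 / (3 * 2)\<^sup>2 = 1 / 18\<close>.\<close>
  have y: "0 \<le> y" "y \<le> 2" using assms pi_less_4 by (auto simp: y_def)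
  have "\<bar>sin y - y\<bar> \<le> y ^ 3 / 6"
    using Maclaurin_sin_bound[of y 3] y by (simp add: sin_coeff_def eval_nat_numeral field_simps)
  then have "sin y \<ge> y - y ^ 3 / 6" by linarith
  moreover have "y ^ 3 \<le> 4 * y"
    using y mult_mono[of y 2 y 2] mult_right_mono[of "y * y" 4 y] by (simp add: eval_nat_numeral)
  ultimately have "sin y \<ge> y / 3" by linarith
  then have "(y / 3)\<^sup>2 \<le> (sin y)\<^sup>2" using y by (intro power_mono) auto
  moreover have "cos x = 1 - 2 * (sin y)\<^sup>2"
    using cos_double_sin[of y] by (simp add: y_def)
  ultimately show ?thesis by (simp add: y_def power_divide)
qed

text \<open>Only the first two terms of the exponential series are used: they already have different
  phases, which yields the gain \<open>1 - cos \<theta>\<close>.\<close>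

lemma norm_exp_minus_one_le:
  fixes a \<theta> :: real
  assumes a: "a > 0"
  shows "cmod (exp (of_real a * cis \<theta>) - 1) \<le> exp a - 1 - a\<^sup>2 * (1 - cos \<theta>) / (2 + a)"
proof -
  define w where "w = of_real a * cis \<theta>"
  have nw: "cmod w = a" using a by (simp add: w_def norm_mult)
  let ?r = "\<lambda>x n. inverse (fact (n + 3)) *\<^sub>R x ^ (n + 3)"
  have e: "exp x = 1 + x + x\<^sup>2 / 2 + (\<Sum>n. ?r x n)" for x :: "'a :: {real_normed_field, banach}"
    by (subst exp_first_terms[of _ 3]) (simp add: eval_nat_numeral scaleR_conv_of_real field_simps)
  have sm: "summable (\<lambda>n. ?r a n)"
    using summable_exp_generic[of a] by (subst summable_iff_shift) (simp add: summable_exp_generic)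
  have "cmod (\<Sum>n. ?r w n) \<le> (\<Sum>n. ?r a n)"
    by (rule norm_suminf_le) (use sm in \<open>auto simp: norm_power nw\<close>)
  also have "\<dots> = exp a - 1 - a - a\<^sup>2 / 2" using e[of a] by simp
  finally have 1: "cmod (\<Sum>n. ?r w n) \<le> exp a - 1 - a - a\<^sup>2 / 2" .
  have "(cmod (1 + w / 2))\<^sup>2 = (1 + a * cos \<theta> / 2)\<^sup>2 + (a * sin \<theta> / 2)\<^sup>2"
    by (simp add: cmod_power2 w_def)
  also have "\<dots> = 1 + a * cos \<theta> + a\<^sup>2 / 4 * (cos \<theta>)\<^sup>2 + a\<^sup>2 / 4 * (sin \<theta>)\<^sup>2"
    by (simp add: power2_eq_square algebra_simps)
  also have "\<dots> = (1 + a / 2)\<^sup>2 - a * (1 - cos \<theta>)"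
    by (simp only: add.assoc distrib_left[symmetric] sin_cos_squared_add2)
      (simp add: power2_eq_square algebra_simps)
  \<comment> \<open>Completing the square: for the gain
    \<open>g = a * (1 - cos \<theta>) / (2 + a)\<close>, twice \<open>(1 + a / 2) * g\<close> is
    exactly \<open>a * (1 - cos \<theta>)\<close>. Taking roots later requires
    \<open>g \<le> 1 + a / 2\<close>.\<close>
  also have "\<dots> \<le> (1 + a / 2)\<^sup>2 - a * (1 - cos \<theta>) + (a * (1 - cos \<theta>) / (2 + a))\<^sup>2"
    by simp
  also have "\<dots> = ((1 + a / 2) - a * (1 - cos \<theta>) / (2 + a))\<^sup>2"
    using a by (simp add: power2_eq_square divide_simps) (simp add: algebra_simps)
  finally have sq: "(cmod (1 + w / 2))\<^sup>2 \<le> ((1 + a / 2) - a * (1 - cos \<theta>) / (2 + a))\<^sup>2" .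
  have "a * (1 - cos \<theta>) \<le> a * 2" using a by (intro mult_left_mono) auto
  also have "\<dots> \<le> (1 + a / 2) * (2 + a)" using a mult_pos_pos[OF a a] by (simp add: field_simps)
  finally have nonneg: "a * (1 - cos \<theta>) / (2 + a) \<le> 1 + a / 2" using a by (simp add: pos_divide_le_eq)
  have 2: "cmod (1 + w / 2) \<le> (1 + a / 2) - a * (1 - cos \<theta>) / (2 + a)"
    by (rule power2_le_imp_le[OF sq]) (use nonneg in simp)
  have "1 + w + w\<^sup>2 / 2 + s - 1 = w * (1 + w / 2) + s" for s
    by (simp add: algebra_simps power2_eq_square)
  then have "exp w - 1 = w * (1 + w / 2) + (\<Sum>n. ?r w n)"
    by (simp only: e[of w])
  then have "cmod (exp w - 1) \<le> a * cmod (1 + w / 2) + cmod (\<Sum>n. ?r w n)"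
    by (metis norm_mult norm_triangle_ineq nw)
  also have "\<dots> \<le> a * ((1 + a / 2) - a * (1 - cos \<theta>) / (2 + a)) + (exp a - 1 - a - a\<^sup>2 / 2)"
    using a 1 2 by (intro add_mono mult_left_mono) auto
  also have "\<dots> = exp a - 1 - a\<^sup>2 * (1 - cos \<theta>) / (2 + a)"
    by (simp add: algebra_simps power2_eq_square)
  finally show ?thesis by (simp add: w_def)
qed

text \<open>The gain is brought into the form of a factor so that the power \<open>j\<close> turns
  it into a Gaussian of width about \<open>1 / sqrt j\<close>; \<open>c\<close> is uniform in the
  tilt \<open>t\<close>.\<close>

lemma norm_step_gf_le:
  obtains c :: real where "c > 0" and "\<And>t \<theta>. \<bar>t\<bar> \<le> 1 \<Longrightarrow> \<bar>\<theta>\<bar> \<le> pi \<Longrightarrow>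
    cmod (exp (of_real (ln 2) * exp (Complex t \<theta>)) - 1) \<le> (exp (ln 2 * exp t) - 1) * exp (- c * \<theta>\<^sup>2)"
proof
  \<comment> \<open>\<open>22680 = 7 * 6\<^sup>2 * 5 * 18\<close>, from \<open>exp a - 1 \<le> 7\<close>, \<open>1/6 \<le> a \<le> 3\<close> and the constant
    of \<open>cos_le_quadratic\<close>\<close>
  show "(1 / 22680 :: real) > 0" by simp
  fix t \<theta> :: real assume t: "\<bar>t\<bar> \<le> 1" and \<theta>: "\<bar>\<theta>\<bar> \<le> pi"
  define a where "a = ln 2 * exp t"
  have ln2: "1 / 2 \<le> ln (2::real)" "ln (2::real) \<le> 1"
    using ln2_ge_two_thirds ln_2_less_1 by auto
  have "exp t \<le> 3" using t exp_le by (metis abs_le_D1 exp_le_cancel_iff order_trans)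
  have "exp (- t) \<le> 3" using t exp_le by (metis abs_le_D2 exp_le_cancel_iff order_trans)
  then have "exp t \<ge> 1 / 3" by (simp add: exp_minus field_simps)
  then have "ln 2 * exp t \<ge> (1/2) * (1/3)" using ln2 by (intro mult_mono) auto
  then have a1: "a \<ge> 1 / 6" by (simp add: a_def)
  have "exp a = 2 powr exp t" by (simp add: a_def powr_def mult.commute)
  also have "\<dots> \<le> 2 powr 3" using \<open>exp t \<le> 3\<close> by (intro powr_mono) auto
  finally have ea: "exp a \<le> 8" by simp
  have "ln 2 * exp t \<le> 1 * 3" using ln2 \<open>exp t \<le> 3\<close> by (intro mult_mono) auto
  then have a3: "a \<le> 3" by (simp add: a_def)
  have apos: "a > 0" using a1 by simp
  have E: "exp a - 1 > 0" using apos by simp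
  have Ccis: "of_real (ln 2) * exp (Complex t \<theta>) = of_real a * cis \<theta>"
    by (simp add: exp_eq_polar a_def)
  have "(exp a - 1) * (1 / 22680 * \<theta>\<^sup>2) \<le> 7 * (1 / 22680 * \<theta>\<^sup>2)"
    using ea by (intro mult_right_mono) auto
  also have "\<dots> = (1/6)\<^sup>2 * (\<theta>\<^sup>2 / 18) / (2 + 3)" by (simp add: power2_eq_square)
  also have "\<dots> \<le> a\<^sup>2 * (1 - cos \<theta>) / (2 + a)"
    using a1 a3 cos_le_quadratic[OF \<theta>] by (intro frac_le mult_mono power_mono) auto
  finally have "exp a - 1 - a\<^sup>2 * (1 - cos \<theta>) / (2 + a) \<le> (exp a - 1) * (1 + (- (1 / 22680) * \<theta>\<^sup>2))"
    by (simp add: algebra_simps)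
  also have "\<dots> \<le> (exp a - 1) * exp (- (1 / 22680) * \<theta>\<^sup>2)"
    using E by (intro mult_left_mono exp_ge_add_one_self) auto
  finally show "cmod (exp (of_real (ln 2) * exp (Complex t \<theta>)) - 1) \<le>
      (exp (ln 2 * exp t) - 1) * exp (- (1 / 22680) * \<theta>\<^sup>2)"
    using norm_exp_minus_one_le[OF apos, of \<theta>] unfolding Ccis a_def[symmetric] by linarith
qed

section \<open>Uniform upper bounds for the hitting probabilities\<close>

lemma has_bochner_integral_gaussian:
  fixes a :: real
  assumes "a > 0"
  shows "has_bochner_integral lborel (\<lambda>x. exp (- a * x\<^sup>2)) (sqrt (pi / a))"
proof -
  define \<sigma> where "\<sigma> = 1 / sqrt (2 * a)"
  have \<sigma>: "\<sigma> > 0" "2 * \<sigma>\<^sup>2 = 1 / a" using assms by (auto simp: \<sigma>_def power_divide)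
  have eq: "sqrt (pi / a) * normal_density 0 \<sigma> x = exp (- a * x\<^sup>2)" for x
    using assms \<sigma> by (simp add: normal_density_def real_sqrt_divide mult.assoc)
      (simp add: real_sqrt_mult real_sqrt_divide power_divide \<sigma>_def field_simps)
  have "has_bochner_integral lborel (normal_density 0 \<sigma>) 1"
    using \<sigma> by (simp add: has_bochner_integral_iff)
  then have "has_bochner_integral lborel (\<lambda>x. sqrt (pi / a) * normal_density 0 \<sigma> x) (sqrt (pi / a) * 1)"
    by (rule has_bochner_integral_mult_right)
  then show ?thesis by (simp only: eq mult_1_right)
qed

text \<open>A Chernoff bound sharpened by the local factor \<open>1 / sqrt j\<close>: the modulus is
  taken inside the Cauchy integral, the value at angle 0 is pulled out, and the Gaussian majorant is
  integrated over the whole line.\<close>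

lemma hit_prob_le_tilted:
  obtains C :: real where "C > 0" and "\<And>j m t. j \<ge> 1 \<Longrightarrow> \<bar>t\<bar> \<le> 1 \<Longrightarrow>
    hit_prob j m \<le> C / sqrt j * ((exp (ln 2 * exp t) - 1) ^ j * exp (- (real m * t)))"
proof -
  obtain c :: real where c: "c > 0" and bd: "\<And>t \<theta>. \<bar>t\<bar> \<le> 1 \<Longrightarrow> \<bar>\<theta>\<bar> \<le> pi \<Longrightarrow>
    cmod (exp (of_real (ln 2) * exp (Complex t \<theta>)) - 1) \<le> (exp (ln 2 * exp t) - 1) * exp (- c * \<theta>\<^sup>2)"
    using norm_step_gf_le by blast
  show thesis
  proof (rule that[of "sqrt (pi / c) / (2 * pi)"])
    show "sqrt (pi / c) / (2 * pi) > 0" using c by simp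
    fix j m :: nat and t :: real
    assume j: "j \<ge> 1" and t: "\<bar>t\<bar> \<le> 1"
    define E where "E = (exp (ln 2 * exp t) - 1) ^ j * exp (- (real m * t))"
    define g :: "real \<Rightarrow> complex" where
      "g \<theta> = indicator {-pi..pi} \<theta> *\<^sub>R ((exp (of_real (ln 2) * exp (Complex t \<theta>)) - 1) ^ j
          * exp (- (of_nat m * Complex t \<theta>)))" for \<theta>
    note C = hit_prob_Cauchy[where t = t and j = j and m = m, folded g_def]
    have E0: "E \<ge> 0" by (simp add: E_def)
    have gb: "cmod (g \<theta>) \<le> E * exp (- (c * j) * \<theta>\<^sup>2)" for \<theta>
    proof (cases "\<bar>\<theta>\<bar> \<le> pi")
      case True
      have "cmod (g \<theta>) = cmod (exp (of_real (ln 2) * exp (Complex t \<theta>)) - 1) ^ j * exp (- (real m * t))"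
      proof -
        have "\<theta> \<in> {-pi..pi}" using True by auto
        then show ?thesis by (simp add: g_def norm_mult norm_power)
      qed
      also have "\<dots> \<le> ((exp (ln 2 * exp t) - 1) * exp (- c * \<theta>\<^sup>2)) ^ j * exp (- (real m * t))"
        using bd[OF t True] by (intro mult_right_mono power_mono) auto
      also have "\<dots> = E * exp (- (c * j) * \<theta>\<^sup>2)"
        by (simp add: E_def power_mult_distrib exp_of_nat_mult[symmetric] mult_ac)
      finally show ?thesis .
    next
      case False
      then have "\<theta> \<notin> {-pi..pi}" by auto
      then show ?thesis using E0 by (simp add: g_def)
    qed
    have cj: "c * j > 0" using c j by simp
    have hb: "has_bochner_integral lborel (\<lambda>\<theta>. E * exp (- (c * j) * \<theta>\<^sup>2)) (E * sqrt (pi / (c * j)))"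
      using has_bochner_integral_gaussian[OF cj] by (rule has_bochner_integral_mult_right)
    have "hit_prob j m = cmod (complex_of_real (hit_prob j m))"
      using hit_prob_nonneg[of j m] by simp
    also have "\<dots> = 1 / (2 * pi) * cmod (LINT \<theta>|lborel. g \<theta>)"
      unfolding C(2) by (simp add: norm_mult norm_divide)
    also have "\<dots> \<le> 1 / (2 * pi) * (LINT \<theta>|lborel. E * exp (- (c * j) * \<theta>\<^sup>2))"
    proof (rule mult_left_mono)
      have "cmod (LINT \<theta>|lborel. g \<theta>) \<le> (LINT \<theta>|lborel. cmod (g \<theta>))"
        by (rule integral_norm_bound)
      also have "\<dots> \<le> (LINT \<theta>|lborel. E * exp (- (c * j) * \<theta>\<^sup>2))"
        using C(1) hb gb by (intro integral_mono) (auto simp: has_bochner_integral_iff)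
      finally show "cmod (LINT \<theta>|lborel. g \<theta>) \<le> (LINT \<theta>|lborel. E * exp (- (c * j) * \<theta>\<^sup>2))" .
    qed simp
    also have "\<dots> = 1 / (2 * pi) * (E * sqrt (pi / (c * j)))"
      using hb by (simp only: has_bochner_integral_integral_eq)
    also have "\<dots> = sqrt (pi / c) / (2 * pi) / sqrt j * E"
      by (simp add: real_sqrt_divide real_sqrt_mult mult_ac)
    finally show "hit_prob j m \<le> sqrt (pi / c) / (2 * pi) / sqrt j
        * ((exp (ln 2 * exp t) - 1) ^ j * exp (- (real m * t)))"
      by (simp add: E_def)
  qed
qed

text \<open>The logarithm of the moment generating function of a step starts with the mean times
  \<open>t\<close> plus half the variance times \<open>t\<^sup>2\<close>. Half the variance is
  \<open>ln 2 - ln 2 * ln 2 < 1\<close>, so \<open>K = 1\<close> serves near 0.\<close>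

lemma step_gf_le_exp_quadratic:
  obtains K \<delta> :: real where "K > 0" "\<delta> > 0"
    "\<And>t. \<bar>t\<bar> \<le> \<delta> \<Longrightarrow> exp (ln 2 * exp t) - 1 \<le> exp (2 * ln 2 * t + K * t\<^sup>2)"
proof -
  let ?f = "\<lambda>t::real. ln (exp (ln 2 * exp t) - 1) - 2 * ln 2 * t"
  have "((\<lambda>t. ?f t / t\<^sup>2) \<longlongrightarrow> ln 2 - ln 2 * ln 2) (at 0)"
    by real_asymp
  moreover have "ln 2 - ln 2 * ln 2 < (1::real)"
    using ln_2_less_1 by (smt (verit) mult_nonneg_nonneg ln_gt_zero)
  ultimately have "\<forall>\<^sub>F t in at 0. ?f t / t\<^sup>2 < 1"
    by (rule order_tendstoD(2))
  then obtain d where d: "d > 0" "\<And>t. t \<noteq> 0 \<Longrightarrow> \<bar>t\<bar> < d \<Longrightarrow> ?f t / t\<^sup>2 < 1"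
    by (auto simp: eventually_at dist_real_def)
  show thesis
  proof (rule that[of 1 "d / 2"])
    fix t :: real assume t: "\<bar>t\<bar> \<le> d / 2"
    show "exp (ln 2 * exp t) - 1 \<le> exp (2 * ln 2 * t + 1 * t\<^sup>2)"
    proof (cases "t = 0")
      case False
      then have "?f t \<le> t\<^sup>2" using d(2)[of t] t d(1) by (simp add: pos_divide_less_eq)
      then have "ln (exp (ln 2 * exp t) - 1) \<le> 2 * ln 2 * t + t\<^sup>2" by simp
      then have "exp (ln (exp (ln 2 * exp t) - 1)) \<le> exp (2 * ln 2 * t + 1 * t\<^sup>2)"
        by (simp only: exp_le_cancel_iff mult_1)
      moreover have "exp (ln 2 * exp t) - 1 > 0" by simp
      ultimately show ?thesis by (simp only: exp_ln)
    qed simp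
  qed (use d in auto)
qed

text \<open>Tilting by \<open>t = \<plusminus> 1 / sqrt m\<close> costs only a constant factor for \<open>j \<le> m\<close>.\<close>

lemma hit_prob_le_exp:
  obtains C :: real and m0 :: nat where "C > 0" "m0 > 0" and
    "\<And>j m. m \<ge> m0 \<Longrightarrow> 1 \<le> j \<Longrightarrow> j \<le> m \<Longrightarrow>
      hit_prob j m \<le> C / sqrt j * exp (- \<bar>real m - 2 * ln 2 * j\<bar> / sqrt m)"
proof -
  obtain C :: real where C: "C > 0" and bd: "\<And>j m t. j \<ge> 1 \<Longrightarrow> \<bar>t\<bar> \<le> 1 \<Longrightarrow>
    hit_prob j m \<le> C / sqrt j * ((exp (ln 2 * exp t) - 1) ^ j * exp (- (real m * t)))"
    using hit_prob_le_tilted by blast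
  obtain K \<delta> :: real where K: "K > 0" and \<delta>: "\<delta> > 0" and
    quad: "\<And>t. \<bar>t\<bar> \<le> \<delta> \<Longrightarrow> exp (ln 2 * exp t) - 1 \<le> exp (2 * ln 2 * t + K * t\<^sup>2)"
    using step_gf_le_exp_quadratic by blast
  have "(\<lambda>m. 1 / sqrt (real m)) \<longlonglongrightarrow> 0" by real_asymp
  then have "\<forall>\<^sub>F m in sequentially. 1 / sqrt (real m) < min 1 \<delta>"
    using \<delta> by (intro order_tendstoD(2)) auto
  then obtain m0 where m0: "\<And>m. m \<ge> m0 \<Longrightarrow> 1 / sqrt (real m) < min 1 \<delta>"
    by (auto simp: eventually_sequentially)
  show thesis
  proof (rule that[of "C * exp K" "Suc m0"])
    fix j m :: nat assume m: "Suc m0 \<le> m" and j: "1 \<le> j" "j \<le> m"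
    define d where "d = real m - 2 * ln 2 * j"
    \<comment> \<open>The sign follows that of \<open>d\<close>, so that the tilt gains
      \<open>\<bar>d\<bar> / sqrt m\<close> in the exponent on either side of the mean.\<close>
    define t where "t = (if d \<ge> 0 then 1 else -1) / sqrt m"
    have "\<bar>t\<bar> = 1 / sqrt m" by (simp add: t_def)
    with m0[of m] m have t: "\<bar>t\<bar> \<le> 1" "\<bar>t\<bar> \<le> \<delta>" by auto
    have t2: "t\<^sup>2 = 1 / m" by (simp add: t_def power_divide)
    have "(exp (ln 2 * exp t) - 1) ^ j * exp (- (real m * t)) \<le>
        exp (2 * ln 2 * t + K * t\<^sup>2) ^ j * exp (- (real m * t))"
      using quad[OF t(2)] by (intro mult_right_mono power_mono) auto
    also have "\<dots> = exp (- (d * t) + K * (j / m))"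
      by (simp add: exp_of_nat_mult[symmetric] exp_add[symmetric] d_def t2 algebra_simps)
    also have "\<dots> \<le> exp (- (d * t) + K * 1)"
      using K j m by (intro iffD2[OF exp_le_cancel_iff] add_mono mult_left_mono) auto
    also have "d * t = \<bar>d\<bar> / sqrt m" by (simp add: t_def)
    finally have "(exp (ln 2 * exp t) - 1) ^ j * exp (- (real m * t)) \<le> exp K * exp (- \<bar>d\<bar> / sqrt m)"
      by (simp add: exp_add[symmetric] add.commute)
    then have "C / sqrt j * ((exp (ln 2 * exp t) - 1) ^ j * exp (- (real m * t))) \<le>
        C / sqrt j * (exp K * exp (- \<bar>d\<bar> / sqrt m))"
      using C by (intro mult_left_mono) auto
    with bd[OF j(1) t(1), of m] show "hit_prob j m \<le>
        C * exp K / sqrt j * exp (- \<bar>real m - 2 * ln 2 * j\<bar> / sqrt m)"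
      by (simp add: d_def)
  qed (use C in auto)
qed

section \<open>The local limit theorem\<close>

text \<open>The centred characteristic function of a step agrees with the Gaussian of the same
  variance up to third order; \<open>ln 2 * (1 - ln 2)\<close> is half that variance. A cubic error
  at \<open>u / sqrt n\<close>, multiplied by \<open>n\<close>, still tends to 0.\<close>

lemma step_cf_approx:
  obtains B :: real where "\<And>\<theta>::real. \<bar>\<theta>\<bar> \<le> 1 \<Longrightarrow>
    cmod ((exp (of_real (ln 2) * cis \<theta>) - 1) * cis (- (2 * ln 2 * \<theta>))
        - of_real (exp (- (ln 2 * (1 - ln 2)) * \<theta>\<^sup>2))) \<le> B * \<bar>\<theta>\<bar> ^ 3"
proof -
  \<comment> \<open>the derivatives of order 0, 1, 2 of the difference vanish at 0\<close>
  define l :: complex where "l = of_real (ln 2)"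
  have expl: "exp l = 2" by (simp add: l_def exp_of_real)
  define A where "A z = exp (l * exp (\<i> * z))" for z
  define E where "E z = exp (- (2 * \<i> * l * z))" for z
  define G where "G z = exp (- (l * (1 - l) * z\<^sup>2))" for z
  have dA: "(A has_field_derivative A z * (\<i> * l * exp (\<i> * z))) (at z)" for z
    unfolding A_def by (auto intro!: derivative_eq_intros)
  have dE: "(E has_field_derivative - (2 * \<i> * l) * E z) (at z)" for z
    unfolding E_def by (auto intro!: derivative_eq_intros)
  have dG: "(G has_field_derivative - (2 * l * (1 - l) * z) * G z) (at z)" for z
    unfolding G_def by (auto intro!: derivative_eq_intros)
  have dX: "((\<lambda>z. exp (\<i> * z)) has_field_derivative \<i> * exp (\<i> * z)) (at z)" for z
    by (auto intro!: derivative_eq_intros)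
  define h where "h z = (A z - 1) * E z - G z" for z
  define h1 where "h1 z = \<i> * l * E z * (A z * exp (\<i> * z) - 2 * A z + 2) + 2 * l * (1 - l) * z
      * G z" for z
  define h2 where "h2 z = \<i> * l * (- (2 * \<i> * l) * E z) * (A z * exp (\<i> * z) - 2 * A z + 2)
     + \<i> * l * E z * (A z * (\<i> * l * exp (\<i> * z)) * exp (\<i> * z) + A z * (\<i> * exp (\<i> * z)) - 2
         * (A z * (\<i> * l * exp (\<i> * z))))
     + (2 * l * (1 - l) * G z + 2 * l * (1 - l) * z * (- (2 * l * (1 - l) * z) * G z))" for z
  have d1: "(h has_field_derivative h1 z) (at z)" for z
    unfolding h_def h1_def
    by (rule derivative_eq_intros dA dE dG refl)+ (simp add: algebra_simps)
  have d2: "(h1 has_field_derivative h2 z) (at z)" for z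
    unfolding h1_def h2_def
    by (rule derivative_eq_intros dA dE dG dX refl)+ (simp add: algebra_simps)
  have h012: "h 0 = 0" "h1 0 = 0" "h2 0 = 0"
    by (simp_all add: h_def h1_def h2_def A_def E_def G_def expl algebra_simps)
  have hol: "h holomorphic_on UNIV" using d1 by (auto simp: holomorphic_on_open)
  have deriv1: "deriv h = h1" using d1 by (auto intro: DERIV_imp_deriv)
  have deriv2: "deriv h1 = h2" using d2 by (auto intro: DERIV_imp_deriv)
  have holn: "(deriv ^^ n) h holomorphic_on UNIV" for n
    using hol by (intro holomorphic_higher_deriv) auto
  have "compact ((deriv ^^ 3) h ` cball 0 1)"
    by (intro compact_continuous_image holomorphic_on_imp_continuous_on holomorphic_on_subset[OF
        holn]) auto
  then obtain B where B: "\<And>z. z \<in> cball 0 1 \<Longrightarrow> cmod ((deriv ^^ 3) h z) \<le> B"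
    by (meson compact_imp_bounded bounded_iff image_eqI)
  have hb: "cmod (h z) \<le> B * cmod z ^ 3 / 2" if z: "z \<in> cball 0 1" for z
  proof -
    \<comment> \<open>\<open>complex_Taylor\<close> divides the remainder by \<open>fact 2\<close>,
      whence the constant \<open>B / 2\<close>.\<close>
    have "cmod ((deriv ^^ 0) h z - (\<Sum>i\<le>2. (deriv ^^ i) h 0 * (z - 0) ^ i / fact i)) \<le>
        B * cmod (z - 0) ^ Suc 2 / fact 2"
    proof (rule complex_Taylor[of "cball 0 1"])
      show "((deriv ^^ i) h has_field_derivative (deriv ^^ Suc i) h x) (at x within cball 0 1)" for i x
        using holomorphic_derivI[OF holn[of i], of x] by (simp add: has_field_derivative_at_within)
    qed (use B z in \<open>auto simp: numeral_3_eq_3\<close>)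
    also have "(\<Sum>i\<le>2. (deriv ^^ i) h 0 * (z - 0) ^ i / fact i) = 0"
      by (simp add: numeral_2_eq_2 deriv1 deriv2 h012)
    finally show ?thesis by (simp add: numeral_3_eq_3)
  qed
  show thesis
  proof (rule that[of "B / 2"])
    fix \<theta> :: real assume "\<bar>\<theta>\<bar> \<le> 1"
    moreover have "h (of_real \<theta>) = (exp (of_real (ln 2) * cis \<theta>) - 1) * cis (- (2 * ln 2 * \<theta>))
        - of_real (exp (- (ln 2 * (1 - ln 2)) * \<theta>\<^sup>2))"
      by (simp add: h_def A_def E_def G_def l_def cis_conv_exp mult_ac exp_of_real[symmetric])
    ultimately show "cmod ((exp (of_real (ln 2) * cis \<theta>) - 1) * cis (- (2 * ln 2 * \<theta>))
        - of_real (exp (- (ln 2 * (1 - ln 2)) * \<theta>\<^sup>2))) \<le> B / 2 * \<bar>\<theta>\<bar> ^ 3"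
      using hb[of "of_real \<theta>"] by simp
  qed
qed

text \<open>Complex logarithms are avoided: two numbers of modulus at most 1 have
  \<open>n\<close>-th powers that differ by at most \<open>n\<close> times their distance.\<close>

lemma step_cf_power_tendsto:
  fixes u :: real
  shows "(\<lambda>n. ((exp (of_real (ln 2) * cis (u / sqrt (real n))) - 1)
      * cis (- (2 * ln 2 * (u / sqrt (real n))))) ^ n)
    \<longlonglongrightarrow> of_real (exp (- (ln 2 * (1 - ln 2)) * u\<^sup>2))"
proof -
  let ?v = "ln 2 * (1 - ln 2) :: real"
  let ?\<psi> = "\<lambda>\<theta>. (exp (of_real (ln 2) * cis \<theta>) - 1) * cis (- (2 * ln 2 * \<theta>))"
  obtain B where B: "\<And>\<theta>::real. \<bar>\<theta>\<bar> \<le> 1 \<Longrightarrow> cmod (?\<psi> \<theta> - of_real (exp (- ?v * \<theta>\<^sup>2))) \<le> B * \<bar>\<theta>\<bar> ^ 3"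
    using step_cf_approx by blast
  have v: "?v \<ge> 0" using ln_2_less_1 by simp
  have \<psi>1: "cmod (?\<psi> \<theta>) \<le> 1" for \<theta>
    using norm_exp_minus_one_le[of "ln 2" \<theta>]
        by (simp add: norm_mult) (smt (verit) cos_le_one divide_nonneg_nonneg ln_gt_zero
        mult_nonneg_nonneg zero_le_power2)
  have "(\<lambda>n. ?\<psi> (u / sqrt (real n)) ^ n - of_real (exp (- ?v * u\<^sup>2))) \<longlonglongrightarrow> 0"
  proof (rule tendsto_norm_zero_cancel, rule tendsto_sandwich[OF _ _ tendsto_const])
    have "(\<lambda>n. 1 / sqrt (real n)) \<longlonglongrightarrow> 0" by real_asymp
    then have lim: "(\<lambda>n. c * (1 / sqrt (real n))) \<longlonglongrightarrow> 0" for c :: real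
      using tendsto_mult_right_zero by blast
    show "(\<lambda>n. B * \<bar>u\<bar> ^ 3 * (1 / sqrt (real n))) \<longlonglongrightarrow> 0" by (rule lim)
    have "\<forall>\<^sub>F n in sequentially. \<bar>u\<bar> * (1 / sqrt (real n)) < 1"
      using lim[of "\<bar>u\<bar>"] by (rule order_tendstoD(2)) simp
    moreover have "\<forall>\<^sub>F n in sequentially. n > 0" by (rule eventually_gt_at_top)
    ultimately show "\<forall>\<^sub>F n in sequentially. cmod (?\<psi> (u / sqrt (real n)) ^ n
        - of_real (exp (- ?v * u\<^sup>2))) \<le> B * \<bar>u\<bar> ^ 3 * (1 / sqrt (real n))"
    proof eventually_elim
      case (elim n)
      let ?\<theta> = "u / sqrt (real n)"
      have "exp (- ?v * u\<^sup>2) = exp (- ?v * ?\<theta>\<^sup>2) ^ n"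
        using elim by (simp add: exp_of_nat_mult[symmetric] power_divide)
      then have "cmod (?\<psi> ?\<theta> ^ n - of_real (exp (- ?v * u\<^sup>2))) =
          cmod (?\<psi> ?\<theta> ^ n - of_real (exp (- ?v * ?\<theta>\<^sup>2)) ^ n)"
        by simp
      also have "\<dots> \<le> real n * cmod (?\<psi> ?\<theta> - of_real (exp (- ?v * ?\<theta>\<^sup>2)))"
        using \<psi>1[of ?\<theta>] v by (intro norm_power_diff) simp_all
      also have "\<dots> \<le> real n * (B * \<bar>?\<theta>\<bar> ^ 3)"
        using elim by (intro mult_left_mono B) auto
      also have "\<dots> = B * \<bar>u\<bar> ^ 3 * (1 / sqrt (real n))"
        using elim by (simp add: abs_divide power_divide power3_eq_cube field_simps)
      finally show ?case .
    qed
  qed auto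
  then show ?thesis by (simp add: LIM_zero_iff)
qed

lemma integral_gaussian_cis:
  fixes v y :: real
  assumes v: "v > 0"
  shows "(LINT u|lborel. of_real (exp (- v * u\<^sup>2)) * cis (- (u * y))) =
      of_real (sqrt (pi / v) * exp (- y\<^sup>2 / (4 * v)))"
proof -
  \<comment> \<open>The substitution \<open>x = s * u\<close> turns the exponent
    \<open>- x\<^sup>2 / 2\<close> of the standard normal density into
    \<open>- v * u\<^sup>2\<close>.\<close>
  define s where "s = sqrt (2 * v)"
  have s: "s > 0" "s\<^sup>2 = 2 * v" using v by (auto simp: s_def)
  have "char std_normal_distribution (- y / s) =
      (LINT x|lborel. std_normal_density x *\<^sub>R cis (- y / s * x))"
    unfolding char_def by (subst integral_density) (auto simp: cis_conv_exp mult_ac)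
  also have "\<dots> = s *\<^sub>R (LINT u|lborel. std_normal_density (0 + s * u) *\<^sub>R cis (- y / s * (0 + s * u)))"
    using s by (subst lborel_integral_real_affine[of s _ 0]) auto
  also have "(\<lambda>u. std_normal_density (0 + s * u) *\<^sub>R cis (- y / s * (0 + s * u))) =
      (\<lambda>u. of_real (1 / sqrt (2 * pi)) * (of_real (exp (- v * u\<^sup>2)) * cis (- (u * y))))"
    using s by (auto simp: std_normal_density_def scaleR_conv_of_real power_mult_distrib mult_ac)
  also have "(LINT u|lborel. of_real (1 / sqrt (2 * pi))
      * (of_real (exp (- v * u\<^sup>2)) * cis (- (u * y)))) =
      of_real (1 / sqrt (2 * pi)) * (LINT u|lborel. of_real (exp (- v * u\<^sup>2)) * cis (- (u * y)))"
    by simp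
  finally have "of_real (exp (- y\<^sup>2 / (4 * v))) =
      of_real (s / sqrt (2 * pi)) * (LINT u|lborel. of_real (exp (- v * u\<^sup>2)) * cis (- (u * y)))"
    using s by (simp add: char_std_normal_distribution scaleR_conv_of_real power_divide)
  moreover have "s / sqrt (2 * pi) = 1 / sqrt (pi / v)"
    using v by (simp add: s_def real_sqrt_divide real_sqrt_mult field_simps)
  ultimately show ?thesis
    using v s(1) by (simp add: field_simps)
qed

text \<open>The limit is the density at \<open>y\<close> of the centred normal law with the step
  variance \<open>2 * v\<close>. After the substitution \<open>\<theta> = u / sqrt j\<close> in the
  untilted Cauchy integral, the integrand converges pointwise and is dominated by a fixed Gaussian
  in \<open>u\<close>.\<close>

lemma hit_prob_local_limit:
  fixes js ms :: "nat \<Rightarrow> nat" and y :: real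
  defines "v \<equiv> ln 2 * (1 - ln 2) :: real"
  assumes js: "filterlim js at_top sequentially"
    and y: "(\<lambda>k. (real (ms k) - 2 * ln 2 * real (js k)) / sqrt (real (js k))) \<longlonglongrightarrow> y"
  shows "(\<lambda>k. sqrt (real (js k)) * hit_prob (js k) (ms k)) \<longlonglongrightarrow> exp (- y\<^sup>2 / (4 * v)) / sqrt (4 * pi * v)"
proof -
  have v: "v > 0" using ln_2_less_1 by (simp add: v_def)
  have js_pos: "\<forall>\<^sub>F k in sequentially. js k > 0"
    by (rule eventually_compose_filterlim[OF eventually_gt_at_top js])
  let ?\<phi> = "\<lambda>\<theta>::real. exp (of_real (ln 2) * cis \<theta>) - 1"
  define g :: "nat \<Rightarrow> nat \<Rightarrow> real \<Rightarrow> complex" where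
    "g j m \<theta> = indicator {-pi..pi} \<theta> *\<^sub>R (?\<phi> \<theta> ^ j * cis (- (real m * \<theta>)))" for j m \<theta>
  have hit: "integrable lborel (g j m)" "complex_of_real (hit_prob j m) =
      (1 / (2 * pi)) * (LINT \<theta>|lborel. g j m \<theta>)" for j m
  proof -
    have "g j m = (\<lambda>\<theta>. indicator {-pi..pi} \<theta> *\<^sub>R ((exp (of_real (ln 2) * exp (Complex 0 \<theta>)) - 1) ^ j
        * exp (- (of_nat m * Complex 0 \<theta>))))"
    proof
      fix \<theta> :: real
      have "exp (Complex 0 \<theta>) = cis \<theta>" "exp (- (of_nat m * Complex 0 \<theta>)) = cis (- (real m * \<theta>))"
        by (simp_all add: cis_conv_exp Complex_eq mult_ac)
      then show "g j m \<theta> = indicator {-pi..pi} \<theta> *\<^sub>R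
          ((exp (of_real (ln 2) * exp (Complex 0 \<theta>)) - 1) ^ j * exp (- (of_nat m * Complex 0 \<theta>)))"
        by (simp only: g_def)
    qed
    then show "integrable lborel (g j m)" "complex_of_real (hit_prob j m) =
        (1 / (2 * pi)) * (LINT \<theta>|lborel. g j m \<theta>)"
      using hit_prob_Cauchy[where t = 0 and j = j and m = m] by simp_all
  qed
  obtain c :: real where c: "c > 0" and bd: "\<And>t \<theta>. \<bar>t\<bar> \<le> 1 \<Longrightarrow> \<bar>\<theta>\<bar> \<le> pi \<Longrightarrow>
    cmod (exp (of_real (ln 2) * exp (Complex t \<theta>)) - 1) \<le> (exp (ln 2 * exp t) - 1) * exp (- c * \<theta>\<^sup>2)"
    using norm_step_gf_le by blast
  have bd0: "cmod (?\<phi> \<theta>) \<le> exp (- c * \<theta>\<^sup>2)" if "\<bar>\<theta>\<bar> \<le> pi" for \<theta>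
    using bd[OF _ that, of 0] by (simp add: exp_eq_polar)
  define G where "G k u = g (js k) (ms k) (u / sqrt (real (js k)))" for k u
  have Gbound: "cmod (G k u) \<le> exp (- c * u\<^sup>2)" if "js k > 0" for k u
  proof (cases "\<bar>u / sqrt (real (js k))\<bar> \<le> pi")
    case True
    then have "cmod (G k u) \<le> cmod (?\<phi> (u / sqrt (real (js k)))) ^ js k"
      by (simp add: G_def g_def norm_mult norm_power indicator_def)
    also have "\<dots> \<le> exp (- c * (u / sqrt (real (js k)))\<^sup>2) ^ js k"
      using bd0[OF True] by (intro power_mono) auto
    also have "\<dots> = exp (- c * u\<^sup>2)"
      using that by (simp add: exp_of_nat_mult[symmetric] power_divide)
    finally show ?thesis .
  next
    case False
    then have "u / sqrt (real (js k)) \<notin> {-pi..pi}" by auto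
    then show ?thesis by (simp add: G_def g_def)
  qed
  have Glim: "(\<lambda>k. G k u) \<longlonglongrightarrow> of_real (exp (- v * u\<^sup>2)) * cis (- (u * y))" for u
  proof (rule Lim_transform_eventually)
    let ?\<theta> = "\<lambda>k. u / sqrt (real (js k))"
    have "(\<lambda>k. (?\<phi> (?\<theta> k) * cis (- (2 * ln 2 * ?\<theta> k))) ^ js k) \<longlonglongrightarrow> of_real (exp (- v * u\<^sup>2))"
      using filterlim_compose[OF step_cf_power_tendsto js] by (simp add: v_def)
    moreover have "(\<lambda>k. cis (- (u * ((real (ms k) - 2 * ln 2 * real (js k)) / sqrt (real (js k)))))) \<longlonglongrightarrow>
        cis (- (u * y))"
      by (intro tendsto_cis tendsto_minus tendsto_mult tendsto_const y)
    ultimately show "(\<lambda>k. (?\<phi> (?\<theta> k) * cis (- (2 * ln 2 * ?\<theta> k))) ^ js k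
        * cis (- (u * ((real (ms k) - 2 * ln 2 * real (js k)) / sqrt (real (js k)))))) \<longlonglongrightarrow>
        of_real (exp (- v * u\<^sup>2)) * cis (- (u * y))"
      by (rule tendsto_mult)
    have "(\<lambda>n. u / sqrt (real n)) \<longlonglongrightarrow> 0" by real_asymp
    then have "?\<theta> \<longlonglongrightarrow> 0" using js by (rule filterlim_compose)
    then have "\<forall>\<^sub>F k in sequentially. dist (?\<theta> k) 0 < pi"
      by (rule tendstoD) simp
    with js_pos show "\<forall>\<^sub>F k in sequentially. (?\<phi> (?\<theta> k) * cis (- (2 * ln 2 * ?\<theta> k))) ^ js k
        * cis (- (u * ((real (ms k) - 2 * ln 2 * real (js k)) / sqrt (real (js k))))) = G k u"
    proof eventually_elim
      case (elim k)
      have "?\<theta> k \<in> {-pi..pi}" using elim(2) unfolding dist_real_def diff_0_right atLeastAtMost_iff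
          by linarith
      then have "G k u = ?\<phi> (?\<theta> k) ^ js k * cis (- (real (ms k) * ?\<theta> k))"
        by (simp add: G_def g_def)
      \<comment> \<open>The phase of \<open>ms k\<close> splits into the centring of the
        \<open>js k\<close> steps and the normalised deviation, which tends to
        \<open>y\<close>.\<close>
      moreover have "cis (- (2 * ln 2 * ?\<theta> k)) ^ js k
          * cis (- (u * ((real (ms k) - 2 * ln 2 * real (js k)) / sqrt (real (js k))))) =
          cis (- (real (ms k) * ?\<theta> k))"
        by (simp add: Complex.DeMoivre cis_mult diff_divide_distrib algebra_simps)
      ultimately show ?case
        by (simp add: power_mult_distrib mult.assoc)
    qed
  qed
  have "(\<lambda>k. LINT u|lborel. G k u) \<longlonglongrightarrow> (LINT u|lborel. of_real (exp (- v * u\<^sup>2)) * cis (- (u * y)))"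
  proof -
    \<comment> \<open>Dominated convergence wants the majorant for every index, so the sequence is
      shifted past those with \<open>js k = 0\<close>.\<close>
    obtain N where N: "\<And>k. k \<ge> N \<Longrightarrow> js k > 0"
      using js_pos by (auto simp: eventually_sequentially)
    have "(\<lambda>k. LINT u|lborel. G (k + N) u) \<longlonglongrightarrow>
        (LINT u|lborel. of_real (exp (- v * u\<^sup>2)) * cis (- (u * y)))"
    proof (rule integral_dominated_convergence)
      show "integrable lborel (\<lambda>u. exp (- c * u\<^sup>2))"
        using has_bochner_integral_gaussian[OF c] by (simp add: has_bochner_integral_iff)
      show "AE u in lborel. (\<lambda>k. G (k + N) u) \<longlonglongrightarrow> of_real (exp (- v * u\<^sup>2)) * cis (- (u * y))"
        using LIMSEQ_ignore_initial_segment[OF Glim] by simp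
      show "AE u in lborel. cmod (G (k + N) u) \<le> exp (- c * u\<^sup>2)" for k
        using Gbound N by simp
      show "G (k + N) \<in> borel_measurable lborel" for k
      proof -
        have "(\<lambda>u. g (js (k + N)) (ms (k + N)) (u / sqrt (real (js (k + N))))) \<in> borel_measurable lborel"
          by (intro measurable_compose[OF _ borel_measurable_integrable[OF hit(1)]]) simp
        then show ?thesis by (simp add: G_def[abs_def])
      qed
      show "(\<lambda>u. of_real (exp (- v * u\<^sup>2)) * cis (- (u * y))) \<in> borel_measurable lborel"
        by (intro borel_measurable_continuous_onI continuous_intros | simp)+
    qed
    then show ?thesis by (rule LIMSEQ_offset)
  qed
  then have "(\<lambda>k. (1 / (2 * pi)) * (LINT u|lborel. G k u)) \<longlonglongrightarrow>
      complex_of_real (1 / (2 * pi)) * of_real (sqrt (pi / v) * exp (- y\<^sup>2 / (4 * v)))"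
    unfolding integral_gaussian_cis[OF v] by (intro tendsto_mult) auto
  moreover have "\<forall>\<^sub>F k in sequentially. (1 / (2 * pi)) * (LINT u|lborel. G k u) =
      complex_of_real (sqrt (real (js k)) * hit_prob (js k) (ms k))"
  proof -
    from js_pos show ?thesis
    proof eventually_elim
      case (elim k)
      let ?r = "sqrt (real (js k))"
      have "(LINT \<theta>|lborel. g (js k) (ms k) \<theta>) =
          \<bar>1 / ?r\<bar> *\<^sub>R (LINT u|lborel. g (js k) (ms k) (0 + 1 / ?r * u))"
        using elim by (intro lborel_integral_real_affine) simp
      also have "\<dots> = of_real (1 / ?r) * (LINT u|lborel. G k u)"
        by (simp add: G_def scaleR_conv_of_real)
      finally show ?case using elim by (simp add: hit(2))
    qed
  qed
  ultimately have "(\<lambda>k. complex_of_real (sqrt (real (js k)) * hit_prob (js k) (ms k))) \<longlonglongrightarrow>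
      complex_of_real ((1 / (2 * pi)) * (sqrt (pi / v) * exp (- y\<^sup>2 / (4 * v))))"
    by (auto dest: Lim_transform_eventually)
  then have "(\<lambda>k. sqrt (real (js k)) * hit_prob (js k) (ms k)) \<longlonglongrightarrow>
      (1 / (2 * pi)) * (sqrt (pi / v) * exp (- y\<^sup>2 / (4 * v)))"
    by (simp only: tendsto_of_real_iff)
  moreover have "(1 / (2 * pi)) * sqrt (pi / v) = 1 / sqrt (4 * pi * v)"
  proof -
    have "sqrt (pi / v) * sqrt (4 * pi * v) = sqrt ((2 * pi)\<^sup>2)"
      using v by (simp add: power2_eq_square flip: real_sqrt_mult)
    also have "\<dots> = 2 * pi" by (simp only: real_sqrt_abs) simp
    finally show ?thesis using v by (simp add: field_simps)
  qed
  ultimately show ?thesis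
    by (simp only: mult.assoc[symmetric]) (simp only: times_divide_eq_left mult_1)
qed

section \<open>The rescaled sum as a Gaussian integral\<close>

text \<open>Writing the sum as an integral of a step function makes dominated convergence available.
  The whole half-line \<open>y \<le> 0\<close> is sent to index 0, so integrability hinges on
  \<open>a 0 = 0\<close>.\<close>

lemma has_bochner_integral_nat_ceiling:
  fixes a :: "nat \<Rightarrow> real"
  assumes "a 0 = 0" and "\<And>j. j > N \<Longrightarrow> a j = 0"
  shows "has_bochner_integral lborel (\<lambda>y :: real. a (nat \<lceil>y\<rceil>)) (\<Sum>j\<le>N. a j)"
proof -
  have hb: "has_bochner_integral lborel (\<lambda>y. \<Sum>j\<in>{1..N}. a j * indicator {real j - 1<..real j} y)
      (\<Sum>j\<in>{1..N}. a j * 1)"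
    by (intro has_bochner_integral_sum has_bochner_integral_mult_right)
      (auto intro!: has_bochner_integral_real_indicator[THEN has_bochner_integral_cong[THEN iffD1,
          rotated -1]] simp: has_bochner_integral_iff)
  have eq: "(\<Sum>j\<in>{1..N}. a j * indicator {real j - 1<..real j} y) = a (nat \<lceil>y\<rceil>)" for y :: real
  proof -
    have iff: "real j - 1 < y \<and> y \<le> real j \<longleftrightarrow> j = nat \<lceil>y\<rceil>" if "j \<ge> 1" for j :: nat
      using that by (auto simp: ceiling_eq_iff nat_eq_iff) linarith+
    have "(\<Sum>j\<in>{1..N}. a j * indicator {real j - 1<..real j} y) =
        (\<Sum>j\<in>{1..N}. if j = nat \<lceil>y\<rceil> then a j else 0)"
      using iff by (intro sum.cong) (auto simp: indicator_def)
    also have "\<dots> = (if nat \<lceil>y\<rceil> \<in> {1..N} then a (nat \<lceil>y\<rceil>) else 0)"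
      by simp
    also have "\<dots> = a (nat \<lceil>y\<rceil>)"
    proof -
      have "(if k \<in> {1..N} then a k else 0) = a k" for k
        using assms by (cases "k = 0"; cases "k \<le> N") auto
      then show ?thesis .
    qed
    finally show ?thesis .
  qed
  have sm: "(\<Sum>j\<in>{1..N}. a j * 1) = (\<Sum>j\<le>N. a j)"
    using assms(1) by (intro sum.mono_neutral_cong_left) (auto simp: Suc_le_eq)
  show ?thesis using hb unfolding eq sm .
qed

text \<open>The local limit theorem on the scale \<open>sqrt m\<close>, common to both walks,
  instead of \<open>sqrt (js m)\<close>; the ratio of the scales tends to
  \<open>1 / sqrt \<mu>\<close>, which produces the powers of \<open>\<mu>\<close>.\<close>

lemma hit_prob_limit_along:
  fixes js qs :: "nat \<Rightarrow> nat" and x :: real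
  defines "\<mu> \<equiv> 2 * ln 2 :: real" and "v \<equiv> ln 2 * (1 - ln 2) :: real"
  assumes js: "(\<lambda>m. real (js m) / real m) \<longlonglongrightarrow> 1 / \<mu>"
    and qs: "(\<lambda>m. (real (qs m) - \<mu> * real (js m)) / sqrt (real m)) \<longlonglongrightarrow> - \<mu> * x"
  shows "(\<lambda>m. sqrt (real m) * hit_prob (js m) (qs m)) \<longlonglongrightarrow>
      sqrt \<mu> * (exp (- (\<mu> ^ 3 * x\<^sup>2) / (4 * v)) / sqrt (4 * pi * v))"
proof -
  have \<mu>: "\<mu> > 0" by (simp add: \<mu>_def)
  have pos: "\<forall>\<^sub>F m in sequentially. m > (0::nat)" by (rule eventually_gt_at_top)
  have eq: "\<forall>\<^sub>F m in sequentially. real (js m) / real m * real m = real (js m)"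
    using pos by eventually_elim simp
  have "filterlim (\<lambda>m. real (js m) / real m * real m) at_top sequentially"
    by (rule filterlim_tendsto_pos_mult_at_top[OF js _ filterlim_real_sequentially]) (use \<mu> in simp)
  then have "filterlim (\<lambda>m. real (js m)) at_top sequentially"
    by (rule filterlim_cong[OF refl refl eq, THEN iffD1])
  then have top: "filterlim js at_top sequentially"
    by (simp add: filterlim_sequentially_iff_filterlim_real)
  have js_pos: "\<forall>\<^sub>F m in sequentially. js m > 0"
    by (rule eventually_compose_filterlim[OF eventually_gt_at_top top])
  have sq: "(\<lambda>m. sqrt (real (js m) / real m)) \<longlonglongrightarrow> sqrt (1 / \<mu>)"
    by (intro tendsto_real_sqrt js)
  have "(\<lambda>m. ((real (qs m) - \<mu> * real (js m)) / sqrt (real m)) / sqrt (real (js m) / real m)) \<longlonglongrightarrow>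
      (- \<mu> * x) / sqrt (1 / \<mu>)"
    using \<mu> by (intro tendsto_divide qs sq) simp
  moreover have "\<forall>\<^sub>F m in sequentially. ((real (qs m) - \<mu> * real (js m)) / sqrt (real m))
      / sqrt (real (js m) / real m) = (real (qs m) - \<mu> * real (js m)) / sqrt (real (js m))"
    using pos by eventually_elim (simp add: real_sqrt_divide)
  ultimately have "(\<lambda>m. (real (qs m) - \<mu> * real (js m)) / sqrt (real (js m))) \<longlonglongrightarrow> (- \<mu> * x) / sqrt (1 / \<mu>)"
    by (rule Lim_transform_eventually)
  from hit_prob_local_limit[OF top this[unfolded \<mu>_def], folded \<mu>_def v_def]
  have "(\<lambda>m. sqrt (real (js m)) * hit_prob (js m) (qs m) / sqrt (real (js m) / real m))
      \<longlonglongrightarrow> (exp (- ((- \<mu> * x) / sqrt (1 / \<mu>))\<^sup>2 / (4 * v)) / sqrt (4 * pi * v)) / sqrt (1 / \<mu>)"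
    using \<mu> by (intro tendsto_divide sq) simp_all
  moreover have "\<forall>\<^sub>F m in sequentially. sqrt (real (js m)) * hit_prob (js m) (qs m)
      / sqrt (real (js m) / real m) = sqrt (real m) * hit_prob (js m) (qs m)"
    using js_pos by eventually_elim (simp add: real_sqrt_divide)
  ultimately have "(\<lambda>m. sqrt (real m) * hit_prob (js m) (qs m)) \<longlonglongrightarrow>
      (exp (- ((- \<mu> * x) / sqrt (1 / \<mu>))\<^sup>2 / (4 * v)) / sqrt (4 * pi * v)) / sqrt (1 / \<mu>)"
    by (rule Lim_transform_eventually)
  moreover have "((- \<mu> * x) / sqrt (1 / \<mu>))\<^sup>2 = \<mu> ^ 3 * x\<^sup>2"
    using \<mu> by (simp add: power_divide power_mult_distrib power2_eq_square power3_eq_cube)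
  ultimately show ?thesis
    using \<mu> by (simp add: real_sqrt_divide mult.commute)
qed

text \<open>Division by \<open>Suc j\<close> reduces \<open>fact j * fact (Suc j)\<close> to
  \<open>(fact j)\<^sup>2\<close>. The value 0 at \<open>j = 0\<close> suits the step function
  integral; for \<open>m > 0\<close> it agrees with the general formula because
  \<open>hit_prob 0 m = 0\<close>.\<close>

definition weighted_hits :: "nat \<Rightarrow> nat \<Rightarrow> nat \<Rightarrow> real" where
  "weighted_hits m q j = (if j = 0 then 0 else hit_prob j m * hit_prob (Suc j) q / real (Suc j))"

text \<open>Only the first probability is bounded with exponential decay in \<open>x\<close>; the
  second contributes \<open>1 / sqrt j\<close>. Together with \<open>1 / Suc j\<close> this leaves
  \<open>(m / j)\<^sup>2\<close>, and small \<open>j\<close> forces large negative \<open>x\<close>,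
  so that \<open>m / j\<close> is at most a polynomial in \<open>x\<close>.\<close>

lemma weighted_hits_bound:
  fixes d :: nat
  obtains C :: real and m0 :: nat where "C > 0" "m0 > 0" and
    "\<And>m x. m \<ge> m0 \<Longrightarrow> \<bar>(real m)\<^sup>2 * weighted_hits m (m + d) (nat \<lceil>real m / (2 * ln 2) + x
        * sqrt (real m)\<rceil>)\<bar>
       \<le> C * ((4 + 4 * x\<^sup>2)\<^sup>2 * exp (- \<bar>x\<bar>))"
proof -
  define \<mu> :: real where "\<mu> = 2 * ln 2"
  have \<mu>: "\<mu> \<ge> 1" "\<mu> \<le> 2" using ln2_ge_two_thirds ln_2_less_1 by (auto simp: \<mu>_def)
  obtain C1 :: real where C1: "C1 > 0" and b0: "\<And>j m t. j \<ge> 1 \<Longrightarrow> \<bar>t\<bar> \<le> 1 \<Longrightarrow>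
    hit_prob j m \<le> C1 / sqrt j * ((exp (ln 2 * exp t) - 1) ^ j * exp (- (real m * t)))"
    using hit_prob_le_tilted by blast
  \<comment> \<open>No tilt: at \<open>t = 0\<close> the generating function
    \<open>exp (ln 2) - 1\<close> equals 1.\<close>
  have b1: "hit_prob (Suc j) m \<le> C1 / sqrt (Suc j)" for j m
    using b0[of "Suc j" 0 m] by simp
  obtain C2 :: real and m0 :: nat where C2: "C2 > 0" "m0 > 0" and
    b2: "\<And>j m. m \<ge> m0 \<Longrightarrow> 1 \<le> j \<Longrightarrow> j \<le> m \<Longrightarrow>
      hit_prob j m \<le> C2 / sqrt j * exp (- \<bar>real m - \<mu> * j\<bar> / sqrt m)"
    using hit_prob_le_exp unfolding \<mu>_def by blast
  show thesis
  proof (rule that[of "C1 * C2 * exp \<mu>" m0])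
    fix m :: nat and x :: real
    assume m: "m \<ge> m0"
    then have mpos: "real m \<ge> 1" using C2 by linarith
    define y where "y = real m / \<mu> + x * sqrt m"
    define j where "j = nat \<lceil>y\<rceil>"
    have "\<bar>(real m)\<^sup>2 * weighted_hits m (m + d) j\<bar> \<le> C1 * C2 * exp \<mu> * ((4 + 4 * x\<^sup>2)\<^sup>2 * exp (- \<bar>x\<bar>))"
    proof (cases "1 \<le> j \<and> j \<le> m")
      case False
      then have "weighted_hits m (m + d) j = 0"
        by (auto simp: weighted_hits_def hit_prob_def not_le)
      then show ?thesis using C1 C2 by simp
    next
      case True
      then have j: "1 \<le> j" "j \<le> m" by auto
      have jy: "y \<le> j" "j < y + 1" using j by (auto simp: j_def) linarith+
      have sq: "sqrt m \<ge> 1" "sqrt m * sqrt m = m" using mpos by auto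
      have \<mu>y: "\<mu> * y = m + \<mu> * x * sqrt m" using \<mu> by (simp add: y_def field_simps)
      have "\<mu> * y \<le> \<mu> * j" using jy \<mu> by (intro mult_left_mono) auto
      moreover have "\<mu> * j \<le> \<mu> * (y + 1)" using jy \<mu> by (intro mult_left_mono) auto
      ultimately have up: "m + \<mu> * x * sqrt m \<le> \<mu> * j" and lo: "\<mu> * j \<le> m + \<mu> * x * sqrt m + \<mu>"
        using \<mu>y by (simp_all add: distrib_left)
      \<comment> \<open>Rounding \<open>y\<close> up to \<open>j\<close> moves
        \<open>\<mu> * j\<close> by at most \<open>\<mu>\<close>; in the exponent this costs the
        constant factor \<open>exp \<mu>\<close>.\<close>
      have "\<bar>x\<bar> * sqrt m \<le> \<mu> * (\<bar>x\<bar> * sqrt m)"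
        using mult_right_mono[of 1 \<mu> "\<bar>x\<bar> * sqrt m"] \<mu> by simp
      also have "\<dots> = \<bar>\<mu> * x * sqrt m\<bar>" using \<mu> by (simp add: abs_mult)
      also have "\<dots> \<le> \<bar>real m - \<mu> * j\<bar> + \<mu>" using up lo \<mu> by linarith
      also have "\<dots> \<le> \<bar>real m - \<mu> * j\<bar> + \<mu> * sqrt m" using mult_left_mono[of 1 "sqrt m" \<mu>] sq \<mu> by simp
      finally have "(\<bar>x\<bar> - \<mu>) * sqrt m \<le> \<bar>real m - \<mu> * j\<bar>" by (simp add: algebra_simps)
      then have "\<bar>x\<bar> - \<mu> \<le> \<bar>real m - \<mu> * j\<bar> / sqrt m" using sq by (simp add: pos_le_divide_eq)
      then have ex: "exp (- \<bar>real m - \<mu> * j\<bar> / sqrt m) \<le> exp \<mu> * exp (- \<bar>x\<bar>)"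
        by (simp add: exp_add[symmetric])
      \<comment> \<open>The mean inequality lets half of \<open>m\<close> absorb the mixed term,
        leaving \<open>m \<le> 4 * j + 4 * x\<^sup>2\<close>.\<close>
      have "2 * (sqrt m * (\<mu> * \<bar>x\<bar>)) \<le> (sqrt m)\<^sup>2 + (\<mu> * \<bar>x\<bar>)\<^sup>2"
        using sum_squares_bound[of "sqrt m" "\<mu> * \<bar>x\<bar>"] by simp
      moreover have "- (\<mu> * x * sqrt m) \<le> sqrt m * (\<mu> * \<bar>x\<bar>)"
        using abs_ge_minus_self[of "\<mu> * x * sqrt m"] \<mu> by (simp add: abs_mult mult_ac)
      moreover have "(\<mu> * \<bar>x\<bar>)\<^sup>2 \<le> 4 * x\<^sup>2"
        using \<mu> power_mono[of \<mu> 2 2] by (simp add: power_mult_distrib mult_right_mono)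
      moreover have "\<mu> * j \<le> 2 * real j" using \<mu> by (intro mult_right_mono) auto
      ultimately have "m \<le> 4 * real j + 4 * x\<^sup>2" using up by simp
      also have "\<dots> \<le> (4 + 4 * x\<^sup>2) * j"
        using j mult_left_mono[of 1 "real j" "4 * x\<^sup>2"] by (simp add: algebra_simps)
      finally have mj: "m / j \<le> 4 + 4 * x\<^sup>2" using j by (simp add: divide_le_eq)
      have "(real m)\<^sup>2 * weighted_hits m (m + d) j =
          (real m)\<^sup>2 * (hit_prob j m * hit_prob (Suc j) (m + d) / real (Suc j))"
        using j by (simp add: weighted_hits_def)
      also have "\<dots> \<le> (real m)\<^sup>2 * ((C2 / sqrt j * (exp \<mu> * exp (- \<bar>x\<bar>))) * (C1 / sqrt j) / real j)"
      proof (intro mult_left_mono frac_le mult_mono hit_prob_nonneg)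
        have "hit_prob j m \<le> C2 / sqrt j * exp (- \<bar>real m - \<mu> * j\<bar> / sqrt m)"
          using b2[OF m] j by simp
        also have "\<dots> \<le> C2 / sqrt j * (exp \<mu> * exp (- \<bar>x\<bar>))"
          using ex C2 by (intro mult_left_mono) auto
        finally show "hit_prob j m \<le> C2 / sqrt j * (exp \<mu> * exp (- \<bar>x\<bar>))" .
        have "C1 / sqrt (Suc j) \<le> C1 / sqrt j" using C1 j by (intro divide_left_mono) auto
        then show "hit_prob (Suc j) (m + d) \<le> C1 / sqrt j" using b1[of j "m + d"] by linarith
      qed (use C1 C2 j in auto)
      also have "\<dots> = C1 * C2 * exp \<mu> * ((m / j)\<^sup>2 * exp (- \<bar>x\<bar>))"
        using j by (simp add: power2_eq_square field_simps)
      also have "\<dots> \<le> C1 * C2 * exp \<mu> * ((4 + 4 * x\<^sup>2)\<^sup>2 * exp (- \<bar>x\<bar>))"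
        using mj C1 C2 by (intro mult_left_mono mult_right_mono power_mono) auto
      finally show ?thesis
        by (simp add: weighted_hits_def hit_prob_nonneg)
    qed
    then show "\<bar>(real m)\<^sup>2 * weighted_hits m (m + d) (nat \<lceil>real m / (2 * ln 2) + x * sqrt (real m)\<rceil>)\<bar>
        \<le> C1 * C2 * exp \<mu> * ((4 + 4 * x\<^sup>2)\<^sup>2 * exp (- \<bar>x\<bar>))"
      by (simp add: j_def y_def \<mu>_def)
  qed (use C1 C2 in auto)
qed

lemma integrable_polynomial_exp_minus_abs:
  "integrable lborel (\<lambda>x :: real. (4 + 4 * x\<^sup>2)\<^sup>2 * exp (- \<bar>x\<bar>))"
proof (rule Bochner_Integration.integrable_bound)
  let ?g = "\<lambda>k (x :: real). x ^ k * exp (- x) * indicator {0..} x"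
  \<comment> \<open>The coefficients of \<open>(4 + 4 * x\<^sup>2)\<^sup>2\<close>. Adding the
    reflection of \<open>?h\<close> covers the negative half-line.\<close>
  let ?h = "\<lambda>x. 16 * ?g 0 x + 32 * ?g 2 x + 16 * ?g 4 x"
  have g: "integrable lborel (?g k)" for k
    using has_bochner_integral_I0i_power_exp_m'[of k] by (simp add: has_bochner_integral_iff)
  have h: "integrable lborel ?h"
    by (intro Bochner_Integration.integrable_add integrable_mult_right g)
  then show "integrable lborel (\<lambda>x. ?h x + ?h (0 + (-1) * x))"
    by (rule Bochner_Integration.integrable_add[OF _ lborel_integrable_real_affine[OF h]]) simp
  have "(4 + 4 * x\<^sup>2)\<^sup>2 * exp (- \<bar>x\<bar>) \<le> ?h x + ?h (0 + (-1) * x)" for x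
    by (cases "x = 0"; cases "x > 0")
        (auto simp: indicator_def power2_eq_square eval_nat_numeral algebra_simps)
  then show "AE x in lborel. norm ((4 + 4 * x\<^sup>2)\<^sup>2 * exp (- \<bar>x\<bar>)) \<le> norm (?h x + ?h (0 + (-1) * x))"
    by (intro AE_I2) (smt (verit) real_norm_def mult_nonneg_nonneg zero_le_power2 exp_ge_zero)
qed measurable

text \<open>The index is parametrised as \<open>m / \<mu> + x * sqrt m\<close>, so that the sum
  becomes an integral over \<open>x\<close>. The offset \<open>d\<close> between the targets is
  negligible against \<open>sqrt m\<close> and leaves no trace in the limit.\<close>

lemma sum_weighted_hits_tendsto:
  fixes d :: nat
  shows "(\<lambda>m. real m * sqrt (real m) * (\<Sum>j\<le>m. weighted_hits m (m + d) j)) \<longlonglongrightarrow>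
      1 / (2 * sqrt (pi * (1 - ln 2)))"
proof -
  define \<mu> :: real where "\<mu> = 2 * ln 2"
  define v :: real where "v = ln 2 * (1 - ln 2)"
  have \<mu>: "\<mu> > 0" and v: "v > 0" using ln_2_less_1 by (simp_all add: \<mu>_def v_def)
  define J where "J x m = nat \<lceil>real m / \<mu> + x * sqrt (real m)\<rceil>" for x and m :: nat
  define F where "F m x = (real m)\<^sup>2 * weighted_hits m (m + d) (J x m)" for m x
  have pos: "\<forall>\<^sub>F m in sequentially. m > (0::nat)" by (rule eventually_gt_at_top)
  have step: "has_bochner_integral lborel (\<lambda>y :: real. weighted_hits m (m + d) (nat \<lceil>y\<rceil>))
      (\<Sum>j\<le>m. weighted_hits m (m + d) j)" for m
    by (rule has_bochner_integral_nat_ceiling) (auto simp: weighted_hits_def hit_prob_def)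
  have F_eq: "F m x = (real m)\<^sup>2 * weighted_hits m (m + d) (nat \<lceil>real m / \<mu> + sqrt (real m) * x\<rceil>)" for
      m x
    by (simp add: F_def J_def mult.commute)
  have int_F: "(LINT x|lborel. F m x) = real m * sqrt (real m) * (\<Sum>j\<le>m. weighted_hits m (m + d) j)"
      if "m > 0" for m
  proof -
    have "(\<Sum>j\<le>m. weighted_hits m (m + d) j) = (LINT y|lborel. weighted_hits m (m + d) (nat \<lceil>y :: real\<rceil>))"
      using step[of m] by (simp add: has_bochner_integral_iff)
    also have "\<dots> = \<bar>sqrt (real m)\<bar> *\<^sub>R
        (LINT x|lborel. weighted_hits m (m + d) (nat \<lceil>real m / \<mu> + sqrt (real m) * x\<rceil>))"
      using that by (intro lborel_integral_real_affine) simp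
    finally have "real m * sqrt (real m) * (\<Sum>j\<le>m. weighted_hits m (m + d) j) =
        (real m)\<^sup>2 * (LINT x|lborel. weighted_hits m (m + d) (nat \<lceil>real m / \<mu> + sqrt (real m) * x\<rceil>))"
      by (simp add: power2_eq_square)
    then show ?thesis by (simp add: F_eq)
  qed
  have meas: "F m \<in> borel_measurable lborel" for m
  proof -
    have "(\<lambda>y :: real. weighted_hits m (m + d) (nat \<lceil>y\<rceil>)) \<in> borel_measurable lborel"
      using step[of m] by (simp add: has_bochner_integral_iff)
    then have "(\<lambda>x. weighted_hits m (m + d) (nat \<lceil>real m / \<mu> + sqrt (real m) * x\<rceil>)) \<in> borel_measurable
        lborel"
      by (rule measurable_compose[rotated]) simp
    then show ?thesis by (simp add: F_eq[abs_def])
  qed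
  \<comment> \<open>The outer \<open>\<mu>\<close> is the limit of \<open>m / Suc j\<close>; the two
    equal factors are the local limits of the two walks.\<close>
  define f where "f x = \<mu> * ((sqrt \<mu> * (exp (- (\<mu> ^ 3 * x\<^sup>2) / (4 * v)) / sqrt (4 * pi * v)))
      * (sqrt \<mu> * (exp (- (\<mu> ^ 3 * x\<^sup>2) / (4 * v)) / sqrt (4 * pi * v))))" for x
  have lim: "(\<lambda>m. F m x) \<longlonglongrightarrow> f x" for x
  proof -
    \<comment> \<open>The rounding error, which stays bounded and so vanishes on both scales
      \<open>m\<close> and \<open>sqrt m\<close>.\<close>
    define e where "e m = real (J x m) - (real m / \<mu> + x * sqrt (real m))" for m
    have "filterlim (\<lambda>m. real m / \<mu> + x * sqrt (real m)) at_top sequentially"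
      using \<mu> by real_asymp
    then have "\<forall>\<^sub>F m in sequentially. real m / \<mu> + x * sqrt (real m) > 0"
      by (simp add: filterlim_at_top_dense)
    then have e: "\<forall>\<^sub>F m in sequentially. \<bar>e m\<bar> \<le> 1"
      by eventually_elim (simp add: e_def J_def, linarith)
    have e1: "(\<lambda>m. e m / real m) \<longlonglongrightarrow> 0"
    proof (rule Lim_null_comparison)
      show "(\<lambda>m. 1 / real m) \<longlonglongrightarrow> 0" by real_asymp
      show "\<forall>\<^sub>F m in sequentially. norm (e m / real m) \<le> 1 / real m"
        using e by eventually_elim (simp add: divide_right_mono)
    qed
    have e2: "(\<lambda>m. e m / sqrt (real m)) \<longlonglongrightarrow> 0"
    proof (rule Lim_null_comparison)
      show "(\<lambda>m. 1 / sqrt (real m)) \<longlonglongrightarrow> 0" by real_asymp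
      show "\<forall>\<^sub>F m in sequentially. norm (e m / sqrt (real m)) \<le> 1 / sqrt (real m)"
        using e by eventually_elim (simp add: divide_right_mono)
    qed
    have "(\<lambda>m. 1 / \<mu> + x * (1 / sqrt (real m)) + e m / real m) \<longlonglongrightarrow> 1 / \<mu> + x * 0 + 0"
      by (intro tendsto_intros e1) real_asymp
    moreover have "\<forall>\<^sub>F m in sequentially. 1 / \<mu> + x * (1 / sqrt (real m)) + e m / real m =
        real (J x m) / real m"
      using pos by eventually_elim (simp add: e_def field_simps real_div_sqrt)
    ultimately have J1: "(\<lambda>m. real (J x m) / real m) \<longlonglongrightarrow> 1 / \<mu>"
      by (auto dest: Lim_transform_eventually)
    have "(\<lambda>m. real (J x m) / real m + 1 / real m) \<longlonglongrightarrow> 1 / \<mu> + 0"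
      by (intro tendsto_add J1) real_asymp
    then have J2: "(\<lambda>m. real (Suc (J x m)) / real m) \<longlonglongrightarrow> 1 / \<mu>"
      by (simp add: add_divide_distrib add.commute)
    have "(\<lambda>m. - \<mu> * x - \<mu> * (e m / sqrt (real m))) \<longlonglongrightarrow> - \<mu> * x - \<mu> * 0"
      by (intro tendsto_intros e2)
    moreover have "\<forall>\<^sub>F m in sequentially. - \<mu> * x - \<mu> * (e m / sqrt (real m)) =
        (real m - \<mu> * real (J x m)) / sqrt (real m)"
      using pos by eventually_elim (use \<mu> in \<open>simp add: e_def field_simps\<close>)
    ultimately have q1: "(\<lambda>m. (real m - \<mu> * real (J x m)) / sqrt (real m)) \<longlonglongrightarrow> - \<mu> * x"
      by (auto dest: Lim_transform_eventually)
    have "(\<lambda>m. (real m - \<mu> * real (J x m)) / sqrt (real m) + (real d - \<mu>) * (1 / sqrt (real m))) \<longlonglongrightarrow>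
        - \<mu> * x + (real d - \<mu>) * 0"
      by (intro tendsto_add tendsto_mult tendsto_const q1) real_asymp
    moreover have "(real m - \<mu> * real (J x m)) / sqrt (real m) + (real d - \<mu>) * (1 / sqrt (real m)) =
        (real (m + d) - \<mu> * real (Suc (J x m))) / sqrt (real m)" for m
      by (simp add: add_divide_distrib diff_divide_distrib algebra_simps)
    ultimately have q2: "(\<lambda>m. (real (m + d) - \<mu> * real (Suc (J x m))) / sqrt (real m)) \<longlonglongrightarrow> - \<mu> * x"
      by simp
    note h1 = hit_prob_limit_along[of "J x" "\<lambda>m. m", folded \<mu>_def v_def, OF J1 q1]
    note h2 = hit_prob_limit_along[of "\<lambda>m. Suc (J x m)" "\<lambda>m. m + d", folded \<mu>_def v_def, OF J2 q2]
    have "(\<lambda>m. 1 / (real (Suc (J x m)) / real m)) \<longlonglongrightarrow> 1 / (1 / \<mu>)"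
      using \<mu> by (intro tendsto_intros J2) simp
    then have "(\<lambda>m. 1 / (real (Suc (J x m)) / real m)) \<longlonglongrightarrow> \<mu>" by simp
    then have "(\<lambda>m. 1 / (real (Suc (J x m)) / real m)
        * ((sqrt (real m) * hit_prob (J x m) m) * (sqrt (real m) * hit_prob (Suc (J x m)) (m + d)))) \<longlonglongrightarrow>
        f x"
      unfolding f_def by (rule tendsto_mult[OF _ tendsto_mult[OF h1 h2]])
    moreover have "\<forall>\<^sub>F m in sequentially. 1 / (real (Suc (J x m)) / real m)
        * ((sqrt (real m) * hit_prob (J x m) m) * (sqrt (real m) * hit_prob (Suc (J x m)) (m + d))) =
        F m x"
      using pos
    proof eventually_elim
      case (elim m)
      have "hit_prob 0 m = 0" using elim by (simp add: hit_prob_def gr0_conv_Suc) fastforce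
      then have "F m x = (real m)\<^sup>2 * (hit_prob (J x m) m * hit_prob (Suc (J x m)) (m + d)
          / real (Suc (J x m)))"
        by (simp add: F_def weighted_hits_def)
      then show ?case
        using elim by (simp add: power2_eq_square)
    qed
    ultimately show ?thesis by (rule Lim_transform_eventually)
  qed
  obtain C :: real and m0 :: nat where C: "C > 0" "m0 > 0" and
    bound: "\<And>m x. m \<ge> m0 \<Longrightarrow> \<bar>F m x\<bar> \<le> C * ((4 + 4 * x\<^sup>2)\<^sup>2 * exp (- \<bar>x\<bar>))"
    using weighted_hits_bound[of d] unfolding F_def J_def \<mu>_def by blast
  \<comment> \<open>Twice the exponent of one local limit, since the two Gaussians are
    multiplied.\<close>
  define a where "a = \<mu> ^ 3 / (2 * v)"
  have a: "a > 0" using \<mu> v by (simp add: a_def)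
  have f_eq: "f x = \<mu>\<^sup>2 / (4 * pi * v) * exp (- a * x\<^sup>2)" for x
  proof -
    have "exp (- (\<mu> ^ 3 * x\<^sup>2) / (4 * v)) * exp (- (\<mu> ^ 3 * x\<^sup>2) / (4 * v)) = exp (- a * x\<^sup>2)"
      using v by (simp add: a_def field_simps flip: exp_add)
    moreover have "sqrt \<mu> * sqrt \<mu> = \<mu>" "sqrt (4 * pi * v) * sqrt (4 * pi * v) = 4 * pi * v"
      using \<mu> v by simp_all
    ultimately show ?thesis
      unfolding f_def power2_eq_square
      by (metis (no_types, opaque_lifting) mult.assoc mult.left_commute times_divide_times_eq
          times_divide_eq_left times_divide_eq_right)
  qed
  have f_int: "has_bochner_integral lborel f (\<mu>\<^sup>2 / (4 * pi * v) * sqrt (pi / a))"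
    unfolding f_eq[abs_def] by (intro has_bochner_integral_mult_right has_bochner_integral_gaussian a)
  have "(\<lambda>m. LINT x|lborel. F (m + m0) x) \<longlonglongrightarrow> (LINT x|lborel. f x)"
  proof (rule integral_dominated_convergence)
    show "f \<in> borel_measurable lborel"
      using f_int borel_measurable_integrable[of lborel f] by (simp add: has_bochner_integral_iff)
    show "integrable lborel (\<lambda>x. C * ((4 + 4 * x\<^sup>2)\<^sup>2 * exp (- \<bar>x\<bar>)))"
      by (intro integrable_mult_right integrable_polynomial_exp_minus_abs)
    show "AE x in lborel. (\<lambda>m. F (m + m0) x) \<longlonglongrightarrow> f x"
      using LIMSEQ_ignore_initial_segment[OF lim] by simp
    show "AE x in lborel. norm (F (m + m0) x) \<le> C * ((4 + 4 * x\<^sup>2)\<^sup>2 * exp (- \<bar>x\<bar>))" for m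
      using bound[of "m + m0"] by simp
  qed (rule meas)
  then have "(\<lambda>m. LINT x|lborel. F m x) \<longlonglongrightarrow> (LINT x|lborel. f x)"
    by (rule LIMSEQ_offset)
  moreover have "\<forall>\<^sub>F m in sequentially. (LINT x|lborel. F m x) =
      real m * sqrt (real m) * (\<Sum>j\<le>m. weighted_hits m (m + d) j)"
    using pos by eventually_elim (rule int_F)
  ultimately have "(\<lambda>m. real m * sqrt (real m) * (\<Sum>j\<le>m. weighted_hits m (m + d) j)) \<longlonglongrightarrow>
      (LINT x|lborel. f x)"
    by (rule Lim_transform_eventually)
  moreover have "(LINT x|lborel. f x) = 1 / (2 * sqrt (pi * (1 - ln 2)))"
  proof -
    have "(LINT x|lborel. f x) = \<mu>\<^sup>2 / (4 * pi * v) * sqrt (pi / a)"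
      using f_int by (rule has_bochner_integral_integral_eq)
    also have "\<dots> = 1 / (2 * sqrt (pi * (1 - ln 2)))"
    \<comment> \<open>Squaring removes the roots: both sides are positive and have square
      \<open>\<mu> / (8 * pi * v)\<close>.\<close>
    proof (rule power2_eq_imp_eq)
      have "(\<mu>\<^sup>2 / (4 * pi * v) * sqrt (pi / a))\<^sup>2 = \<mu> / (8 * pi * v)"
        using a \<mu> v by (simp add: power_mult_distrib power_divide a_def field_simps power2_eq_square
            power3_eq_cube)
      also have "\<dots> = 1 / (4 * (pi * (1 - ln 2)))"
        using ln_2_less_1 by (simp add: \<mu>_def v_def)
      also have "\<dots> = (1 / (2 * sqrt (pi * (1 - ln 2))))\<^sup>2"
        using ln_2_less_1 by (simp add: power_divide power_mult_distrib)
      finally show "(\<mu>\<^sup>2 / (4 * pi * v) * sqrt (pi / a))\<^sup>2 = (1 / (2 * sqrt (pi * (1 - ln 2))))\<^sup>2" .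
    qed (use a v ln_2_less_1 in auto)
    finally show ?thesis .
  qed
  ultimately show ?thesis by simp
qed

section \<open>The excedance asymptotics\<close>

text \<open>The central binomial coefficient over \<open>4 ^ r\<close> is, up to sign,
  \<open>-1/2\<close> choose \<open>r\<close>; its asymptotics bring in
  \<open>Gamma (1/2) = sqrt pi\<close>.\<close>

lemma central_binomial_asymptotics:
  "(\<lambda>r. 4 ^ r * (fact r)\<^sup>2 / (fact (2 * r) * sqrt (real r))) \<longlonglongrightarrow> sqrt pi"
proof -
  have c: "fact (2 * r) / (4 ^ r * (fact r)\<^sup>2) = (-1) ^ r * ((-1/2 :: real) gchoose r)" for r
  proof (induction r)
    case (Suc r)
    have rec: "(-1/2 :: real) gchoose Suc r = ((-1/2 - real r) * ((-1/2) gchoose r)) / real (Suc r)"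
      using gbinomial_mult_1[of "-1/2 :: real" r] by (simp add: field_simps)
    have "(-1) ^ Suc r * ((-1/2 :: real) gchoose Suc r) =
        (1/2 + real r) / real (Suc r) * ((-1) ^ r * ((-1/2) gchoose r))"
      by (simp only: rec power_Suc) (simp add: field_simps)
    also have "\<dots> = (1/2 + real r) / real (Suc r) * (fact (2 * r) / (4 ^ r * (fact r)\<^sup>2))"
      by (simp only: Suc.IH)
    also have "\<dots> = fact (2 * Suc r) / (4 ^ Suc r * (fact (Suc r))\<^sup>2)"
    proof -
      have 1: "(fact (2 * Suc r) :: real) = 4 * real (Suc r) * (1/2 + real r) * fact (2 * r)"
        by (simp add: algebra_simps)
      have 2: "(fact (Suc r))\<^sup>2 = (real (Suc r))\<^sup>2 * (fact r)\<^sup>2"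
        by (simp add: power_mult_distrib)
      show ?thesis
        unfolding 1 2 by (simp add: power2_eq_square del: of_nat_Suc)
    qed
    finally show ?case by simp
  qed simp
  have "(\<lambda>r. ((-1/2 :: real) gchoose r) / ((-1) ^ r / exp ((-1/2 + 1) * of_real (ln (real r))))) \<longlonglongrightarrow>
      inverse (Gamma (- (-1/2)))"
    by (rule gbinomial_asymptotic)
  moreover have "\<forall>\<^sub>F r in sequentially. ((-1/2 :: real) gchoose r)
      / ((-1) ^ r / exp ((-1/2 + 1) * of_real (ln (real r)))) =
      inverse (4 ^ r * (fact r)\<^sup>2 / (fact (2 * r) * sqrt (real r)))"
    using eventually_gt_at_top[of 0]
  proof eventually_elim
    case (elim r)
    have "exp (ln (real r) / 2) = sqrt (real r)"
      using elim by (simp add: ln_sqrt[symmetric])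
    moreover have "((-1/2 :: real) gchoose r) / (-1) ^ r = fact (2 * r) / (4 ^ r * (fact r)\<^sup>2)"
      unfolding c by (cases "even r") auto
    ultimately show ?case by (simp add: field_simps)
  qed
  ultimately have "(\<lambda>r. inverse (4 ^ r * (fact r)\<^sup>2 / (fact (2 * r) * sqrt (real r)))) \<longlonglongrightarrow>
      inverse (sqrt pi)"
    by (auto dest: Lim_transform_eventually simp: Gamma_one_half_real)
  from tendsto_inverse[OF this] show ?thesis by simp
qed

lemma count_bras_eq_sum_weighted_hits:
  assumes r: "0 < r" "r < n"
  shows "real (count_bras n r) = fact r * fact (Suc (n - r)) / ln 2 ^ Suc n
      * (\<Sum>j\<le>r. weighted_hits r (Suc (n - r)) j)"
proof -
  let ?q = "Suc (n - r)"
  have "real ((fact j)\<^sup>2 * Stirling r j * Stirling ?q (Suc j)) =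
      fact r * fact ?q / ln 2 ^ Suc n * weighted_hits r ?q j" for j
  proof (cases "j = 0")
    case True
    then show ?thesis using r by (cases r) (auto simp: weighted_hits_def)
  next
    case False
    \<comment> \<open>The two normalisations by powers of \<open>ln 2\<close> combine to an exponent
      that is the same for every \<open>j\<close>.\<close>
    have "r + ?q = Suc n" using r by simp
    then have "(ln 2 :: real) ^ Suc n = ln 2 ^ r * ln 2 ^ ?q" by (metis power_add)
    then show ?thesis
      using False by (simp add: weighted_hits_def hit_prob_def power2_eq_square del: power_Suc fact_Suc)
        (simp add: field_simps)
  qed
  then show ?thesis
    unfolding count_bras_eq_sum_Stirling[OF r(2)] of_nat_sum by (simp only: sum_distrib_left)
qed

text \<open>The even indices are written \<open>2 * k + 2\<close> so that
  \<open>(n - 1) div 2 = k\<close> in both classes.\<close>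

lemma LIMSEQ_odd_even:
  fixes f :: "nat \<Rightarrow> 'a::metric_space"
  assumes "(\<lambda>k. f (2 * k + 1)) \<longlonglongrightarrow> l" "(\<lambda>k. f (2 * k + 2)) \<longlonglongrightarrow> l"
  shows "f \<longlonglongrightarrow> l"
proof (rule metric_LIMSEQ_I)
  fix e :: real assume "e > 0"
  then obtain M N where M: "\<And>k. k \<ge> M \<Longrightarrow> dist (f (2 * k + 1)) l < e"
    and N: "\<And>k. k \<ge> N \<Longrightarrow> dist (f (2 * k + 2)) l < e"
    using assms by (metis metric_LIMSEQ_D)
  have "dist (f n) l < e" if n: "n \<ge> 2 * M + 2 * N + 2" for n
  proof (cases "even n")
    case True
    then obtain k where "n = 2 * k" by blast
    then show ?thesis using N[of "k - 1"] n by (cases k) auto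
  next
    case False
    then obtain k where "n = 2 * k + 1" by (metis oddE)
    then show ?thesis using M[of k] n by auto
  qed
  then show "\<exists>no. \<forall>n\<ge>no. dist (f n) l < e" by blast
qed

theorem theorem1p2:
  shows "(\<lambda>n. real (count_bras n ((n - 1) div 2)) / ((1 / (2 * ln 2)) ^ n * fact n))
           \<longlonglongrightarrow> 1 / (2 * ln 2 * sqrt (1 - ln 2))"
proof (rule LIMSEQ_odd_even)
  define L :: real where "L = ln 2"
  have L: "0 < L" "L < 1" using ln_2_less_1 by (auto simp: L_def)
  let ?X = "\<lambda>r. 4 ^ r * (fact r)\<^sup>2 / (fact (2 * r) * sqrt (real r)) :: real"
  let ?S = "\<lambda>d r. real r * sqrt (real r) * (\<Sum>j\<le>r. weighted_hits r (r + d) j)"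
  let ?f = "\<lambda>n. real (count_bras n ((n - 1) div 2)) / ((1 / (2 * ln 2)) ^ n * fact n)"
  \<comment> \<open>The three limits to be multiplied: the central binomial ratio, a rational
    function of \<open>r\<close>, and the scaled sum.\<close>
  have const: "sqrt pi * inverse L * (1 / (2 * sqrt (pi * (1 - ln 2)))) =
      1 / (2 * ln 2 * sqrt (1 - ln 2))"
    unfolding real_sqrt_mult L_def by (simp add: divide_simps)
  have pos: "\<forall>\<^sub>F r in sequentially. r > (0::nat)" by (rule eventually_gt_at_top)
  \<comment> \<open>For \<open>n = 2 * r + 1\<close> this is what remains of the quotient once
    \<open>?X r\<close> and \<open>?S 2 r\<close> are split off; the \<open>real r\<close> in the
    denominator balances the scaling in \<open>?S\<close>.\<close>
  have "(\<lambda>r. 2 * (real r + 1) * (real r + 2) / ((2 * real r + 1) * real r * L)) \<longlonglongrightarrow> inverse L"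
    using L by real_asymp
  then have "(\<lambda>r. ?X r * (2 * (real r + 1) * (real r + 2) / ((2 * real r + 1) * real r * L)) * ?S 2 r)
      \<longlonglongrightarrow> 1 / (2 * ln 2 * sqrt (1 - ln 2))"
    unfolding const[symmetric] by (intro tendsto_mult central_binomial_asymptotics
        sum_weighted_hits_tendsto)
  moreover have "\<forall>\<^sub>F r in sequentially. ?X r
      * (2 * (real r + 1) * (real r + 2) / ((2 * real r + 1) * real r * L)) * ?S 2 r = ?f (2 * r + 1)"
    using pos
  proof eventually_elim
    case (elim r)
    let ?W = "\<Sum>j\<le>r. weighted_hits r (r + 2) j"
    have half: "(2 * r + 1 - 1) div 2 = r" by simp
    have count: "real (count_bras (2 * r + 1) r) = fact r * fact (r + 2) / (L ^ (2 * r + 1) * L) * ?W"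
      using count_bras_eq_sum_weighted_hits[of r "2 * r + 1"] elim by (simp add: L_def mult_ac)
    have fact_r: "(fact (r + 2) :: real) = (real r + 1) * (real r + 2) * fact r"
      by (simp add: algebra_simps)
    have fact_n: "(fact (2 * r + 1) :: real) = (2 * real r + 1) * fact (2 * r)"
      by (simp add: algebra_simps)
    have pow: "(1 / (2 * L)) ^ (2 * r + 1) = 1 / (2 * 4 ^ r * L ^ (2 * r + 1))"
      by (simp add: power_divide power_mult_distrib power_mult)
    \<comment> \<open>Factorials, powers and the square root become opaque variables, leaving a pure
      field identity.\<close>
    have alg: "P * F\<^sup>2 / (G * s) * (2 * (R + 1) * (R + 2) / ((2 * R + 1) * R * L)) * (R * s * W) =
      F * ((R + 1) * (R + 2) * F) / (Q * L) * W / (1 / (2 * P * Q) * ((2 * R + 1) * G))"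
      if "F > 0" "G > 0" "P > 0" "Q > 0" "s > 0" "R > 0" for F G P Q s R W :: real
      using that L by (simp add: divide_simps power2_eq_square)
    show ?case
      unfolding half L_def[symmetric] count fact_r fact_n pow by (rule alg) (use elim L in simp_all)
  qed
  ultimately show "(\<lambda>r. ?f (2 * r + 1)) \<longlonglongrightarrow> 1 / (2 * ln 2 * sqrt (1 - ln 2))"
    by (rule Lim_transform_eventually)
  \<comment> \<open>For \<open>n = 2 * r + 2\<close> the second walk aims at \<open>r + 3\<close>;
    the extra factor \<open>2 * (r + 3) / (2 * r + 2)\<close> tends to 1, so both parities share the
    limit.\<close>
  have "(\<lambda>r. 4 * (real r + 1) * (real r + 2) * (real r + 3)
      / ((2 * real r + 1) * (2 * real r + 2) * real r * L)) \<longlonglongrightarrow> inverse L"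
    using L by real_asymp
  then have "(\<lambda>r. ?X r * (4 * (real r + 1) * (real r + 2) * (real r + 3)
      / ((2 * real r + 1) * (2 * real r + 2) * real r * L)) * ?S 3 r) \<longlonglongrightarrow> 1 / (2 * ln 2 * sqrt (1 - ln 2))"
    unfolding const[symmetric] by (intro tendsto_mult central_binomial_asymptotics
        sum_weighted_hits_tendsto)
  moreover have "\<forall>\<^sub>F r in sequentially. ?X r
      * (4 * (real r + 1) * (real r + 2) * (real r + 3)
      / ((2 * real r + 1) * (2 * real r + 2) * real r * L)) * ?S 3 r = ?f (2 * r + 2)"
    using pos
  proof eventually_elim
    case (elim r)
    let ?W = "\<Sum>j\<le>r. weighted_hits r (r + 3) j"
    have half: "(2 * r + 2 - 1) div 2 = r" by simp
    have "Suc (2 * r + 2 - r) = r + 3" by simp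
    then have count: "real (count_bras (2 * r + 2) r) =
        fact r * fact (r + 3) / (L ^ (2 * r + 2) * L) * ?W"
      using count_bras_eq_sum_weighted_hits[of r "2 * r + 2"] elim
      by (simp only: L_def power_Suc mult.commute)
    have fact_r: "(fact (r + 3) :: real) = (real r + 1) * (real r + 2) * (real r + 3) * fact r"
      by (simp add: eval_nat_numeral algebra_simps)
    have fact_n: "(fact (2 * r + 2) :: real) = (2 * real r + 1) * (2 * real r + 2) * fact (2 * r)"
      by (simp add: algebra_simps)
    have pow: "(1 / (2 * L)) ^ (2 * r + 2) = 1 / (4 * 4 ^ r * L ^ (2 * r + 2))"
      by (simp add: power_divide power_mult_distrib power_mult)
    have alg: "P * F\<^sup>2 / (G * s) * (4 * (R + 1) * (R + 2) * (R + 3)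
        / ((2 * R + 1) * (2 * R + 2) * R * L)) * (R * s * W) =
      F * ((R + 1) * (R + 2) * (R + 3) * F) / (Q * L) * W
          / (1 / (4 * P * Q) * ((2 * R + 1) * (2 * R + 2) * G))"
      if "F > 0" "G > 0" "P > 0" "Q > 0" "s > 0" "R > 0" for F G P Q s R W :: real
      using that L by (simp add: divide_simps power2_eq_square)
    show ?case
      unfolding half L_def[symmetric] count fact_r fact_n pow by (rule alg) (use elim L in simp_all)
  qed
  ultimately show "(\<lambda>r. ?f (2 * r + 2)) \<longlonglongrightarrow> 1 / (2 * ln 2 * sqrt (1 - ln 2))"
    by (rule Lim_transform_eventually)
qed

end
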